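(* Let $F=\alpha+\beta$ be a conformally flat non-Riemannian Randers metric on an $n$-dimensional manifold $M$ with $n\geq 2$. If $F$ is of weakly isotropic scalar curvature, i.e. there exist a $1$-form $\theta=\theta_i(x)y^i$ and a scalar function $\mu=\mu(x)$ on $M$ such that $$\mathbf{r}=n(n-1)\left[\frac{\theta}{F}+\mu(x)\right],$$ then $F$ must be locally Minkowskian.
   Context: Manifolds are taken to be connected. A Randers metric on a smooth manifold $M$ is a Finsler metric of the form $F=\alpha+\beta$, where $\alpha=\sqrt{a_{ij}(x)y^iy^j}$ is a Riemannian metric and $\beta=b_i(x)y^i$ is a $1$-form with $\|\beta_x\|_\alpha<1$ for all $x\in M$. Here $(x^i,y^i)$ are the standard local coordinates on $TM$, $y=y^i\frac{\partial}{\partial x^i}\in T_xM$. The metric $F=\alpha+\beta$ is non-Riemannian if it is not a Riemannian metric, i.e. $\beta$ is not identically zero. A Finsler metric is (locally) Minkowskian if around every point there are local coordinates $(x^i)$ in which $F(x,y)$ does not depend on $x$. Two Finsler metrics $F,\bar F$ on $M$ are conformally related if $F=e^{\kappa(x)}\bar F$ for some scalar function $\kappa$ on $M$; $F$ is conformally flat if it is conformally related to a (locally) Minkowskian metric $\bar F$ on $M$. For a Finsler metric $F$ on an $n$-dimensional manifold $M$, put $g_{ij}:=\frac12[F^2]_{y^iy^j}$ and $(g^{ij}):=(g_{ij})^{-1}$. All quantities below are considered for $y\neq 0$. The geodesic coefficients are $$G^k=\tfrac14 g^{kl}\{[F^2]_{x^my^l}y^m-[F^2]_{x^l}\}.$$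 The Riemann curvature is $$R^i_{\ k}=2G^i_{x^k}-G^i_{x^jy^k}y^j+2G^jG^i_{y^jy^k}-G^i_{y^j}G^j_{y^k}.$$ The Ricci curvature is $\mathbf{Ric}(x,y):=R^m_{\ m}(x,y)$, the (Akbar-Zadeh) Ricci curvature tensor is $\mathbf{Ric}_{ij}:=\frac12\mathbf{Ric}_{y^iy^j}$, and the scalar curvature is $\mathbf{r}:=g^{ij}\mathbf{Ric}_{ij}$ (a function of $(x,y)$). *)

theory Defs
  imports "HOL-Analysis.Analysis"
begin

section \<open>Smooth maps and smooth manifolds\<close>

text \<open>\<open>Ck_on k S f\<close> is only used for open \<open>S\<close> in a finite-dimensional space, where it is the
  usual notion of a map of class \<open>C^k\<close>.\<close>

primrec Ck_on :: "nat \<Rightarrow> 'a::real_normed_vector set \<Rightarrow> ('a \<Rightarrow> 'b::real_normed_vector) \<Rightarrow> bool" where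
  "Ck_on 0 S f \<longleftrightarrow> continuous_on S f"
| "Ck_on (Suc k) S f \<longleftrightarrow>
     f differentiable_on S \<and> (\<forall>v. Ck_on k S (\<lambda>x. frechet_derivative f (at x) v))"

definition smooth_on :: "'a::real_normed_vector set \<Rightarrow> ('a \<Rightarrow> 'b::real_normed_vector) \<Rightarrow> bool" where
  "smooth_on S f \<longleftrightarrow> (\<forall>k. Ck_on k S f)"

text \<open>A chart is a pair \<open>(U, \<phi>)\<close>; the values of \<open>\<phi>\<close> outside \<open>U\<close> are irrelevant.\<close>

type_synonym ('m, 'n) chart = "'m set \<times> ('m \<Rightarrow> real ^ 'n)"

abbreviation chart_dom :: "('m, 'n) chart \<Rightarrow> 'm set" where
  "chart_dom c \<equiv> fst c"

definition chart_img :: "('m, 'n) chart \<Rightarrow> (real ^ 'n) set" where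
  "chart_img c = snd c ` fst c"

definition chart_inv :: "('m, 'n) chart \<Rightarrow> real ^ 'n \<Rightarrow> 'm" where
  "chart_inv c = inv_into (fst c) (snd c)"

definition is_chart :: "'m topology \<Rightarrow> ('m, 'n::finite) chart \<Rightarrow> bool" where
  "is_chart M c \<longleftrightarrow> openin M (chart_dom c) \<and> open (chart_img c) \<and>
     homeomorphic_map (subtopology M (chart_dom c)) (top_of_set (chart_img c)) (snd c)"

definition smooth_transition :: "('m, 'n::finite) chart \<Rightarrow> ('m, 'n) chart \<Rightarrow> bool" where
  "smooth_transition c d \<longleftrightarrow>
     smooth_on (snd c ` (chart_dom c \<inter> chart_dom d)) (snd d \<circ> chart_inv c)"

text \<open>The smooth structure is given by a maximal atlas \<open>A\<close>, so that the members of \<open>A\<close> are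
  exactly the local coordinate systems of the manifold. Connectedness is not part of it.\<close>

definition smooth_manifold :: "'m topology \<Rightarrow> ('m, 'n::finite) chart set \<Rightarrow> bool" where
  "smooth_manifold M A \<longleftrightarrow>
     Hausdorff_space M \<and> second_countable M \<and>
     (\<forall>c\<in>A. is_chart M c) \<and> (\<Union>c\<in>A. chart_dom c) = topspace M \<and>
     (\<forall>c\<in>A. \<forall>d\<in>A. smooth_transition c d) \<and>
     (\<forall>c. is_chart M c \<and> (\<forall>d\<in>A. smooth_transition c d \<and> smooth_transition d c) \<longrightarrow> c \<in> A)"

section \<open>Tangent vectors and functions on the tangent bundle\<close>

text \<open>A tangent vector at \<open>p\<close> is the family of its components \<open>(y^i)\<close> in all charts around
  \<open>p\<close>, related by the Jacobians of the coordinate changes; the components in the remaining charts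
  are set to \<open>0\<close>. A function on the tangent bundle is a curried function of \<open>p\<close> and of a tangent
  vector at \<open>p\<close>, its values elsewhere being irrelevant.\<close>

type_synonym ('m, 'n) tvector = "('m, 'n) chart \<Rightarrow> real ^ 'n"

definition tangent_space :: "('m, 'n::finite) chart set \<Rightarrow> 'm \<Rightarrow> ('m, 'n) tvector set" where
  "tangent_space A p = {v.
     (\<forall>c\<in>A. \<forall>d\<in>A. p \<in> chart_dom c \<inter> chart_dom d \<longrightarrow>
        v d = frechet_derivative (snd d \<circ> chart_inv c) (at (snd c p)) (v c)) \<and>
     (\<forall>c. \<not> (c \<in> A \<and> p \<in> chart_dom c) \<longrightarrow> v c = 0)}"

text \<open>\<open>coord_tvector A c x y\<close> is the tangent vector \<open>y^i (\<partial>/\<partial>x^i)\<close> at the point with coordinates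
  \<open>x\<close> in the chart \<open>c\<close>, and \<open>local_rep A c F\<close> is \<open>F(x, y)\<close> in the induced coordinates
  \<open>(x^i, y^i)\<close> of the tangent bundle.\<close>

definition coord_tvector ::
    "('m, 'n::finite) chart set \<Rightarrow> ('m, 'n) chart \<Rightarrow> real ^ 'n \<Rightarrow> real ^ 'n \<Rightarrow> ('m, 'n) tvector" where
  "coord_tvector A c x y = (\<lambda>d. if d \<in> A \<and> chart_inv c x \<in> chart_dom d
     then frechet_derivative (snd d \<circ> chart_inv c) (at x) y else 0)"

definition local_rep :: "('m, 'n::finite) chart set \<Rightarrow> ('m, 'n) chart \<Rightarrow>
    ('m \<Rightarrow> ('m, 'n) tvector \<Rightarrow> real) \<Rightarrow> real ^ 'n \<Rightarrow> real ^ 'n \<Rightarrow> real" where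
  "local_rep A c F = (\<lambda>x y. F (chart_inv c x) (coord_tvector A c x y))"

definition smooth_scalar :: "('m, 'n::finite) chart set \<Rightarrow> ('m \<Rightarrow> real) \<Rightarrow> bool" where
  "smooth_scalar A f \<longleftrightarrow> (\<forall>c\<in>A. smooth_on (chart_img c) (f \<circ> chart_inv c))"

definition one_form :: "('m, 'n::finite) chart set \<Rightarrow> ('m \<Rightarrow> ('m, 'n) tvector \<Rightarrow> real) \<Rightarrow> bool" where
  "one_form A \<beta> \<longleftrightarrow> (\<forall>c\<in>A. \<exists>b :: real ^ 'n \<Rightarrow> real ^ 'n. smooth_on (chart_img c) b \<and>
     (\<forall>x\<in>chart_img c. \<forall>y. local_rep A c \<beta> x y = (\<Sum>i\<in>UNIV. b x $ i * y $ i)))"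

text \<open>A Riemannian metric is represented by its norm, \<open>\<alpha> = sqrt (a_ij(x) y^i y^j)\<close>.\<close>

definition riemannian_metric ::
    "('m, 'n::finite) chart set \<Rightarrow> ('m \<Rightarrow> ('m, 'n) tvector \<Rightarrow> real) \<Rightarrow> bool" where
  "riemannian_metric A \<alpha> \<longleftrightarrow> (\<forall>c\<in>A. \<exists>a :: real ^ 'n \<Rightarrow> real ^ 'n ^ 'n. smooth_on (chart_img c) a \<and>
     (\<forall>x\<in>chart_img c. transpose (a x) = a x \<and> (\<forall>y. y \<noteq> 0 \<longrightarrow> 0 < y \<bullet> (a x *v y)) \<and>
        (\<forall>y. local_rep A c \<alpha> x y = sqrt (\<Sum>i\<in>UNIV. \<Sum>j\<in>UNIV. a x $ i $ j * y $ i * y $ j))))"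

section \<open>Partial derivatives and curvature in local coordinates\<close>

definition pdx :: "'n::finite \<Rightarrow> (real ^ 'n \<Rightarrow> real ^ 'n \<Rightarrow> real) \<Rightarrow> real ^ 'n \<Rightarrow> real ^ 'n \<Rightarrow> real" where
  "pdx i f = (\<lambda>x y. deriv (\<lambda>t. f (x + t *\<^sub>R axis i 1) y) 0)"

definition pdy :: "'n::finite \<Rightarrow> (real ^ 'n \<Rightarrow> real ^ 'n \<Rightarrow> real) \<Rightarrow> real ^ 'n \<Rightarrow> real ^ 'n \<Rightarrow> real" where
  "pdy i f = (\<lambda>x y. deriv (\<lambda>t. f x (y + t *\<^sub>R axis i 1)) 0)"

definition sq :: "(real ^ 'n \<Rightarrow> real ^ 'n \<Rightarrow> real) \<Rightarrow> real ^ 'n \<Rightarrow> real ^ 'n \<Rightarrow> real" where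
  "sq f = (\<lambda>x y. (f x y)\<^sup>2)"

text \<open>In what follows \<open>f\<close> is the local representation \<open>F(x, y)\<close> of a Finsler metric. An iterated
  subscript such as \<open>[f]_{x^m y^l}\<close> means: differentiate by \<open>x^m\<close> first, then by \<open>y^l\<close>.\<close>

definition fund_tensor ::
    "(real ^ 'n \<Rightarrow> real ^ 'n \<Rightarrow> real) \<Rightarrow> real ^ 'n \<Rightarrow> real ^ 'n \<Rightarrow> real ^ 'n::finite ^ 'n" where
  "fund_tensor f x y = (\<chi> i j. pdy j (pdy i (sq f)) x y / 2)"

definition fund_tensor_inv ::
    "(real ^ 'n \<Rightarrow> real ^ 'n \<Rightarrow> real) \<Rightarrow> real ^ 'n \<Rightarrow> real ^ 'n \<Rightarrow> real ^ 'n::finite ^ 'n" where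
  "fund_tensor_inv f x y = matrix_inv (fund_tensor f x y)"

definition geodesic_coeff ::
    "(real ^ 'n \<Rightarrow> real ^ 'n \<Rightarrow> real) \<Rightarrow> 'n::finite \<Rightarrow> real ^ 'n \<Rightarrow> real ^ 'n \<Rightarrow> real" where
  "geodesic_coeff f k = (\<lambda>x y. 1 / 4 * (\<Sum>l\<in>UNIV. fund_tensor_inv f x y $ k $ l *
     ((\<Sum>m\<in>UNIV. pdy l (pdx m (sq f)) x y * y $ m) - pdx l (sq f) x y)))"

definition riemann_curvature ::
    "(real ^ 'n \<Rightarrow> real ^ 'n \<Rightarrow> real) \<Rightarrow> 'n::finite \<Rightarrow> 'n \<Rightarrow> real ^ 'n \<Rightarrow> real ^ 'n \<Rightarrow> real" where
  "riemann_curvature f i k = (let G = geodesic_coeff f in (\<lambda>x y.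
     2 * pdx k (G i) x y
     - (\<Sum>j\<in>UNIV. pdy k (pdx j (G i)) x y * y $ j)
     + 2 * (\<Sum>j\<in>UNIV. G j x y * pdy k (pdy j (G i)) x y)
     - (\<Sum>j\<in>UNIV. pdy j (G i) x y * pdy k (G j) x y)))"

definition ricci_curvature ::
    "(real ^ 'n \<Rightarrow> real ^ 'n \<Rightarrow> real) \<Rightarrow> real ^ 'n::finite \<Rightarrow> real ^ 'n \<Rightarrow> real" where
  "ricci_curvature f = (\<lambda>x y. \<Sum>m\<in>UNIV. riemann_curvature f m m x y)"

definition ricci_tensor ::
    "(real ^ 'n \<Rightarrow> real ^ 'n \<Rightarrow> real) \<Rightarrow> 'n::finite \<Rightarrow> 'n \<Rightarrow> real ^ 'n \<Rightarrow> real ^ 'n \<Rightarrow> real" where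
  "ricci_tensor f i j = (\<lambda>x y. pdy j (pdy i (ricci_curvature f)) x y / 2)"

definition scalar_curvature ::
    "(real ^ 'n \<Rightarrow> real ^ 'n \<Rightarrow> real) \<Rightarrow> real ^ 'n::finite \<Rightarrow> real ^ 'n \<Rightarrow> real" where
  "scalar_curvature f = (\<lambda>x y. \<Sum>i\<in>UNIV. \<Sum>j\<in>UNIV.
     fund_tensor_inv f x y $ i $ j * ricci_tensor f i j x y)"

section \<open>Finsler metrics\<close>

definition finsler_metric ::
    "('m, 'n::finite) chart set \<Rightarrow> ('m \<Rightarrow> ('m, 'n) tvector \<Rightarrow> real) \<Rightarrow> bool" where
  "finsler_metric A F \<longleftrightarrow> (\<forall>c\<in>A. let f = local_rep A c F in
     smooth_on (chart_img c \<times> (- {0})) (\<lambda>(x, y). f x y) \<and>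
     (\<forall>x\<in>chart_img c.
        (\<forall>y. 0 \<le> f x y) \<and>
        (\<forall>y t. 0 < t \<longrightarrow> f x (t *\<^sub>R y) = t * f x y) \<and>
        (\<forall>y u. y \<noteq> 0 \<longrightarrow> u \<noteq> 0 \<longrightarrow> 0 < u \<bullet> (fund_tensor f x y *v u))))"

text \<open>The norm of the covector \<open>\<beta>_p\<close> dual to \<open>\<alpha>_p\<close>. The set is bounded since the tangent space
  is finite-dimensional, and symmetric about \<open>0\<close>, so no absolute value is needed.\<close>

definition dual_norm :: "('m, 'n::finite) chart set \<Rightarrow> ('m \<Rightarrow> ('m, 'n) tvector \<Rightarrow> real) \<Rightarrow>
    ('m \<Rightarrow> ('m, 'n) tvector \<Rightarrow> real) \<Rightarrow> 'm \<Rightarrow> real" where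
  "dual_norm A \<alpha> \<beta> p = Sup {\<beta> p v / \<alpha> p v | v. v \<in> tangent_space A p \<and> v \<noteq> (\<lambda>_. 0)}"

definition randers_metric ::
    "'m topology \<Rightarrow> ('m, 'n::finite) chart set \<Rightarrow> ('m \<Rightarrow> ('m, 'n) tvector \<Rightarrow> real) \<Rightarrow> bool" where
  "randers_metric M A F \<longleftrightarrow> finsler_metric A F \<and>
     (\<exists>\<alpha> \<beta>. riemannian_metric A \<alpha> \<and> one_form A \<beta> \<and>
        (\<forall>p\<in>topspace M. dual_norm A \<alpha> \<beta> p < 1) \<and>
        (\<forall>p\<in>topspace M. \<forall>v\<in>tangent_space A p. F p v = \<alpha> p v + \<beta> p v))"

definition locally_minkowskian ::
    "'m topology \<Rightarrow> ('m, 'n::finite) chart set \<Rightarrow> ('m \<Rightarrow> ('m, 'n) tvector \<Rightarrow> real) \<Rightarrow> bool" where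
  "locally_minkowskian M A F \<longleftrightarrow> finsler_metric A F \<and>
     (\<forall>p\<in>topspace M. \<exists>c\<in>A. p \<in> chart_dom c \<and>
        (\<forall>x\<in>chart_img c. \<forall>x'\<in>chart_img c. \<forall>y. local_rep A c F x y = local_rep A c F x' y))"

definition conformally_related :: "'m topology \<Rightarrow> ('m, 'n::finite) chart set \<Rightarrow>
    ('m \<Rightarrow> ('m, 'n) tvector \<Rightarrow> real) \<Rightarrow> ('m \<Rightarrow> ('m, 'n) tvector \<Rightarrow> real) \<Rightarrow> bool" where
  "conformally_related M A F F' \<longleftrightarrow> (\<exists>\<kappa>. smooth_scalar A \<kappa> \<and>
     (\<forall>p\<in>topspace M. \<forall>v\<in>tangent_space A p. F p v = exp (\<kappa> p) * F' p v))"

definition conformally_flat ::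
    "'m topology \<Rightarrow> ('m, 'n::finite) chart set \<Rightarrow> ('m \<Rightarrow> ('m, 'n) tvector \<Rightarrow> real) \<Rightarrow> bool" where
  "conformally_flat M A F \<longleftrightarrow> (\<exists>F'. locally_minkowskian M A F' \<and> conformally_related M A F F')"

definition weakly_isotropic_scalar_curvature ::
    "('m, 'n::finite) chart set \<Rightarrow> ('m \<Rightarrow> ('m, 'n) tvector \<Rightarrow> real) \<Rightarrow> bool" where
  "weakly_isotropic_scalar_curvature A F \<longleftrightarrow> (\<exists>\<theta> \<mu>. one_form A \<theta> \<and> smooth_scalar A \<mu> \<and>
     (\<forall>c\<in>A. \<forall>x\<in>chart_img c. \<forall>y. y \<noteq> 0 \<longrightarrow>
        scalar_curvature (local_rep A c F) x y =
          real CARD('n) * (real CARD('n) - 1) *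
            (local_rep A c \<theta> x y / local_rep A c F x y + \<mu> (chart_inv c x))))"

end

(* In a chart that is Minkowskian for the flat metric, F = e^kappa f with a fixed Randers norm
   f = alpha + beta.  Its spray is G^i = P y^i - A^i, where A is regular and P has a simple pole along
   f = 0.  At the complex zeros of f the Ricci curvature therefore has the double pole
   3/4 (n - 1) (1 - |b|^2)^2 alpha^2 (d kappa)^2 / f^2, and contracting its Hessian with the inverse
   fundamental tensor turns this into a pole of order 5 of the scalar curvature, whereas the weakly
   isotropic expression has only a simple pole.  Hence d kappa (y) = 0 whenever f (y) = 0 for complex y;
   these zeros already span the complexified tangent space on the circles cos t e + sin t u with e
   parallel to b and u orthogonal to it, where f vanishes at cos t = - 1 / |b|.  So d kappa = 0, and
   kappa is constant by connectedness.  The form beta vanishes either everywhere or nowhere, as its zero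
   set is open and closed. *)
theory Submission
  imports Defs "HOL-Complex_Analysis.Conformal_Mappings"
begin

section \<open>Partial derivatives along coordinate axes\<close>

text \<open>For real \<open>y\<close> no pole is ever met: the norm is positive away from 0, so the
  order of a pole has no meaning for functions of real vectors. It gets one algebraically. All
  functions that occur lie in a ring generated by constants, linear forms, \<open>alpha\<close>,
  \<open>1 / alpha\<close> and \<open>1 / f\<close>, and a statement about a pole is an identity
  \<open>f^m * g = lead + f * q\<close> on nonzero real vectors with \<open>q\<close> in the subring
  that lacks \<open>1 / f\<close>. On a circle \<open>alpha = 1\<close> the members of this subring
  are restrictions of entire functions, so the identity survives continuation to complex zeros of
  \<open>f\<close>, where it reduces to \<open>lead = 0\<close>. This is why denominators are
  cleared throughout and remainders are given explicitly: it is their membership in the subring that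
  matters, not their values. Grading the ring by degree makes Euler's identity available for every
  member. Contractions with \<open>y\<close> therefore never need the second derivatives themselves,
  and this keeps the pole of the scalar curvature at order 5, although a Hessian with a pole of
  order 4 meets an inverse fundamental tensor with one of order 3.\<close>

definition dirderiv :: "'n::finite \<Rightarrow> (real ^ 'n \<Rightarrow> real) \<Rightarrow> real ^ 'n
      \<Rightarrow> real" where
  "dirderiv i g = (\<lambda>y. deriv (\<lambda>t. g (y + t *\<^sub>R axis i 1)) 0)"

definition has_dirderiv :: "'n::finite \<Rightarrow> (real ^ 'n \<Rightarrow> real) \<Rightarrow> real ^ 'n
      \<Rightarrow> real \<Rightarrow> bool" where
  "has_dirderiv i g y l \<longleftrightarrow> ((\<lambda>t. g (y + t *\<^sub>R axis i 1)) has_real_derivative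
        l) (at 0)"

lemma pdy_eq: "pdy i F x y = dirderiv i (F x) y"
  by (simp add: pdy_def dirderiv_def)

lemma dirderivI: "has_dirderiv i g y l \<Longrightarrow> dirderiv i g y = l"
  unfolding has_dirderiv_def dirderiv_def by (rule DERIV_imp_deriv)

lemma eventually_axis_line:
  fixes y :: "real ^ 'n::finite"
  assumes "open S" "y \<in> S"
  shows "\<forall>\<^sub>F t in nhds 0. y + t *\<^sub>R axis i 1 \<in> S"
proof -
  have "((\<lambda>t::real. y + t *\<^sub>R axis i 1) \<longlongrightarrow> y + 0 *\<^sub>R axis i 1) (nhds 0)"
    by (intro tendsto_intros filterlim_ident)
  then show ?thesis using assms by (auto dest: topological_tendstoD)
qed

text \<open>Most identities below are available only for \<open>y \<noteq> 0\<close> or on the image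
  of a chart. As these sets are open, the identities may still be differentiated.\<close>

lemma has_dirderiv_cong:
  fixes y :: "real ^ 'n::finite"
  assumes "open S" "y \<in> S" "\<And>y. y \<in> S \<Longrightarrow> g y = h y"
  shows "has_dirderiv i g y l \<longleftrightarrow> has_dirderiv i h y l"
  unfolding has_dirderiv_def
  by (rule DERIV_cong_ev)
     (use eventually_axis_line[OF assms(1,2), of i] assms(3) in \<open>auto elim!: eventually_mono\<close>)

lemma dirderiv_cong:
  fixes y :: "real ^ 'n::finite"
  assumes "open S" "y \<in> S" "\<And>y. y \<in> S \<Longrightarrow> g y = h y"
  shows "dirderiv i g y = dirderiv i h y"
  unfolding dirderiv_def
  by (rule deriv_cong_ev)
     (use eventually_axis_line[OF assms(1,2), of i] assms(3) in \<open>auto elim!: eventually_mono\<close>)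

lemma open_nonzero: "open (- {0 :: 'a::real_normed_vector})" by auto

lemmas dirderiv_cong_nonzero = dirderiv_cong[OF open_nonzero, simplified]
lemmas has_dirderiv_cong_nonzero = has_dirderiv_cong[OF open_nonzero, simplified]

lemma has_dirderiv_const: "has_dirderiv i (\<lambda>_. r) y 0"
  unfolding has_dirderiv_def by simp

lemma has_dirderiv_linear: "has_dirderiv i (\<lambda>y. l \<bullet> y) y (l $ i)"
proof -
  have "(\<lambda>t. l \<bullet> (y + t *\<^sub>R axis i 1)) = (\<lambda>t. l \<bullet> y + t * l $ i)"
    by (auto simp: inner_add_right inner_axis)
  then show ?thesis unfolding has_dirderiv_def by (auto intro!: derivative_eq_intros)
qed

lemma has_dirderiv_add:
  "has_dirderiv i g y l \<Longrightarrow> has_dirderiv i h y m \<Longrightarrow> has_dirderiv i (\<lambda>y. g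
        y + h y) y (l + m)"
  unfolding has_dirderiv_def by (rule DERIV_add)

lemma has_dirderiv_mult:
  "has_dirderiv i g y l \<Longrightarrow> has_dirderiv i h y m \<Longrightarrow>
    has_dirderiv i (\<lambda>y. g y * h y) y (l * h y + g y * m)"
  unfolding has_dirderiv_def by (auto intro!: derivative_eq_intros)

lemma has_dirderiv_inverse:
  "has_dirderiv i g y l \<Longrightarrow> g y \<noteq> 0 \<Longrightarrow> has_dirderiv i (\<lambda>y. 1 / g y)
        y (- l * (1 / g y) * (1 / g y))"
  unfolding has_dirderiv_def by (auto intro!: derivative_eq_intros simp: field_simps)

lemma has_dirderiv_sum:
  "(\<And>j. j \<in> J \<Longrightarrow> has_dirderiv i (g j) y (l j)) \<Longrightarrow>
    has_dirderiv i (\<lambda>y. \<Sum>j\<in>J. g j y) y (\<Sum>j\<in>J. l j)"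
  unfolding has_dirderiv_def by (rule DERIV_sum) auto

lemma matrix_inv_eqI:
  fixes A X :: "real ^ 'n ^ 'n::finite"
  assumes "A ** X = mat 1"
  shows "matrix_inv A = X"
proof -
  have X: "X ** A = mat 1" using assms matrix_left_right_inverse by blast
  have "matrix_inv A ** A = mat 1"
    unfolding matrix_inv_def by (rule someI2[where a = X]) (use assms X in auto)
  then show ?thesis
    by (metis assms matrix_mul_assoc matrix_mul_lid matrix_mul_rid)
qed

section \<open>Randers norms\<close>

text \<open>The bound on the dual norm is encoded as positivity of
  \<open>\<alpha> + \<beta>\<close>; the inequality \<open>|b| < 1\<close> is recovered from it in
  \<open>b_sharp_bounds\<close>.\<close>

locale randers_norm =
  fixes a :: "real ^ 'n ^ 'n::finite" and b :: "real ^ 'n"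
  assumes sym: "transpose a = a"
    and pos: "y \<noteq> 0 \<Longrightarrow> 0 < y \<bullet> (a *v y)"
    and f_pos': "y \<noteq> 0 \<Longrightarrow> 0 < sqrt (y \<bullet> (a *v y)) + b \<bullet> y"
begin

definition "alpha y = sqrt (y \<bullet> (a *v y))"
definition "f y = alpha y + b \<bullet> y"
definition "a_inv = matrix_inv a"
definition "b_sharp = a_inv *v b"
text \<open>\<open>b \<bullet> b_sharp\<close> is the squared norm of the covector \<open>b\<close>
  with respect to \<open>a\<close>, so this is the factor \<open>1 - |b|^2\<close> of the leading
  terms.\<close>

definition "defect = 1 - b \<bullet> b_sharp"

lemma f_pos: "y \<noteq> 0 \<Longrightarrow> 0 < f y" using f_pos' by (simp add: f_def alpha_def)
lemma alpha_pos: "y \<noteq> 0 \<Longrightarrow> 0 < alpha y" using pos by (simp add: alpha_def)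
lemma alpha_sq: "alpha y * alpha y = y \<bullet> (a *v y)"
proof (cases "y = 0")
  case False then show ?thesis using pos[OF False] by (simp add: alpha_def)
qed (simp add: alpha_def)

lemma quad_sum: "(\<Sum>i\<in>UNIV. y $ i * (a $ i \<bullet> y)) = y \<bullet> (a *v y)"
  by (simp add: inner_vec_def matrix_vector_mult_def)

lemma a_inner: "x \<bullet> (a *v y) = (a *v x) \<bullet> y"
  by (metis dot_lmul_matrix sym transpose_matrix_vector)

lemma a_inv_right: "a ** a_inv = mat 1" and a_inv_left: "a_inv ** a = mat 1"
proof -
  have "inj ((*v) a)"
  proof (rule injI)
    fix x y assume "a *v x = a *v y"
    then have "a *v (x - y) = 0" by (simp add: matrix_vector_mult_diff_distrib)
    then show "x = y" using pos[of "x - y"] by auto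
  qed
  then obtain X where "X ** a = mat 1" using matrix_left_invertible_injective by blast
  then have "a ** X = mat 1" "X ** a = mat 1" using matrix_left_right_inverse by blast+
  then show "a ** a_inv = mat 1" "a_inv ** a = mat 1"
    using matrix_inv_eqI by (auto simp: a_inv_def)
qed

lemma a_a_inv [simp]: "a *v (a_inv *v k) = k" and a_inv_a [simp]: "a_inv *v (a *v k) = k"
  by (simp_all add: matrix_vector_mul_assoc a_inv_right a_inv_left)

lemma a_inv_inner: "x \<bullet> (a_inv *v y) = (a_inv *v x) \<bullet> y"
  by (metis a_a_inv a_inner)

text \<open>A graded ring of functions that is closed under partial derivatives; with the flag \<open>s\<close> the
  function \<open>1 / f\<close> is adjoined. The members for \<open>s = False\<close> have no pole at the
        complex zeros of \<open>f\<close>.\<close>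

inductive homog :: "bool \<Rightarrow> int \<Rightarrow> (real ^ 'n \<Rightarrow> real) \<Rightarrow> bool" for
      s where
  homog_const: "homog s 0 (\<lambda>_. r)"
| homog_zero: "homog s d (\<lambda>_. 0)"
| homog_lin: "homog s 1 (\<lambda>y. l \<bullet> y)"
| homog_alpha: "homog s 1 alpha"
| homog_inv_alpha: "homog s (-1) (\<lambda>y. 1 / alpha y)"
| homog_inv_f: "s \<Longrightarrow> homog s (-1) (\<lambda>y. 1 / f y)"
| homog_add: "homog s d g \<Longrightarrow> homog s d h \<Longrightarrow> homog s d (\<lambda>y. g y + h y)"
| homog_mult: "homog s d g \<Longrightarrow> homog s e h \<Longrightarrow> homog s (d + e) (\<lambda>y. g y * h y)"
| homog_cong: "homog s d g \<Longrightarrow> (\<And>y. y \<noteq> 0 \<Longrightarrow> h y = g y)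
      \<Longrightarrow> homog s d h"

lemma homog_mult': "homog s d g \<Longrightarrow> homog s e h \<Longrightarrow> d + e = k \<Longrightarrow>
      homog s k (\<lambda>y. g y * h y)"
  using homog_mult by blast
lemma homog_scale: "homog s d g \<Longrightarrow> homog s d (\<lambda>y. r * g y)"
  using homog_mult[OF homog_const] by simp
lemma homog_scale_right: "homog s d g \<Longrightarrow> homog s d (\<lambda>y. g y * r)"
  using homog_mult[OF _ homog_const] by simp
lemma homog_divide: "homog s d g \<Longrightarrow> homog s d (\<lambda>y. g y / r)"
  using homog_scale_right[of s d g "1 / r"] by simp
lemma homog_minus: "homog s d g \<Longrightarrow> homog s d (\<lambda>y. - g y)"
  using homog_scale[of s d g "-1"] by simp
lemma homog_diff: "homog s d g \<Longrightarrow> homog s d h \<Longrightarrow> homog s d (\<lambda>y. g y - h y)"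
  using homog_add[of s d g "\<lambda>y. - h y"] homog_minus by simp
lemma homog_coord: "homog s 1 (\<lambda>y. y $ i)"
  using homog_lin[of s "axis i 1"] by (simp add: inner_axis')
lemma homog_sum: "finite J \<Longrightarrow> (\<And>j. j \<in> J \<Longrightarrow> homog s d (g j))
      \<Longrightarrow> homog s d (\<lambda>y. \<Sum>j\<in>J. g j y)"
  by (induction J rule: finite_induct) (auto intro: homog_zero homog_add)
lemma homog_f: "homog s 1 f"
  unfolding f_def[abs_def] by (intro homog_add homog_alpha homog_lin)
lemma homog_sq: "homog s 1 g \<Longrightarrow> homog s 2 (\<lambda>y. (g y)\<^sup>2)"
  unfolding power2_eq_square using homog_mult[of s 1 g 1 g] by simp

section \<open>Derivatives and Euler's identity in the graded ring\<close>

lemma has_dirderiv_alpha: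
  assumes "y \<noteq> 0"
  shows "has_dirderiv i alpha y ((a $ i \<bullet> y) * (1 / alpha y))"
proof -
  have "has_dirderiv i (\<lambda>y. \<Sum>j\<in>UNIV. y $ j * (a $ j \<bullet> y)) y
      (\<Sum>j\<in>UNIV. (axis j 1 :: real^'n) $ i * (a $ j \<bullet> y) + y $ j * a $ j $ i)"
    by (rule has_dirderiv_sum)
       (use has_dirderiv_mult[OF has_dirderiv_linear[of i "axis _ 1"] has_dirderiv_linear] in \<open>simp add:
             inner_axis'\<close>)
  moreover have "(\<lambda>y. \<Sum>j\<in>UNIV. y $ j * (a $ j \<bullet> y)) = (\<lambda>y. y \<bullet> (a *v y))"
    by (auto simp: inner_vec_def matrix_vector_mult_def)
  moreover have aji: "a $ j $ i = a $ i $ j" for j using sym by (metis transpose_def vec_lambda_beta)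
  have "(\<Sum>j\<in>UNIV. (axis j 1 :: real^'n) $ i * (a $ j \<bullet> y) + y $ j * a $ j $ i) = 2 * (a $ i
        \<bullet> y)"
    by (simp only: aji sum.distrib) (simp add: axis_def if_distrib if_distribR sum.delta inner_vec_def
          mult.commute cong: if_cong)
  ultimately have d: "has_dirderiv i (\<lambda>y. y \<bullet> (a *v y)) y (2 * (a $ i \<bullet> y))" by simp
  show ?thesis using d pos[OF assms]
    unfolding alpha_def[abs_def] has_dirderiv_def
    by (auto intro!: derivative_eq_intros simp: field_simps)
qed

text \<open>Existence of the derivatives, their membership in the ring and Euler's identity are
  proved by one induction, since the product case of the last two rests on the first.\<close>

lemma homog_deriv_aux:
  "homog s d g \<Longrightarrow> homog s (d - 1) (dirderiv i g) \<and>
    (\<forall>y. y \<noteq> 0 \<longrightarrow> has_dirderiv i g y (dirderiv i g y) \<and> (\<Sum>i\<in>UNIV. y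
          $ i * dirderiv i g y) = of_int d * g y)"
proof -
  \<comment> \<open>\<open>dirderiv\<close> can be computed only once the derivative is known to
    exist. So the induction produces explicit candidates \<open>g'\<close>, and uniqueness of
    derivatives identifies them with \<open>dirderiv\<close> afterwards.\<close>
  have *: "?thesis" if "\<exists>g'. (\<forall>i. homog s (d - 1) (g' i)) \<and> (\<forall>i y. y \<noteq> 0
        \<longrightarrow> has_dirderiv i g y (g' i y))
     \<and> (\<forall>y. y \<noteq> 0 \<longrightarrow> (\<Sum>i\<in>UNIV. y $ i * g' i y) = of_int d * g y)"
  proof -
    from that obtain g' where g': "\<And>i. homog s (d - 1) (g' i)"
      "\<And>i y. y \<noteq> 0 \<Longrightarrow> has_dirderiv i g y (g' i y)"
      "\<And>y. y \<noteq> 0 \<Longrightarrow> (\<Sum>i\<in>UNIV. y $ i * g' i y) = of_int d * g y" by blast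
    have "\<And>i y. y \<noteq> 0 \<Longrightarrow> dirderiv i g y = g' i y" using g'(2) dirderivI by blast
    then show ?thesis using g' by (auto intro: homog_cong)
  qed
  assume "homog s d g"
  then have "\<exists>g'. (\<forall>i. homog s (d - 1) (g' i)) \<and> (\<forall>i y. y \<noteq> 0
        \<longrightarrow> has_dirderiv i g y (g' i y))
     \<and> (\<forall>y. y \<noteq> 0 \<longrightarrow> (\<Sum>i\<in>UNIV. y $ i * g' i y) = of_int d * g y)"
  proof (induction rule: homog.induct)
    case (homog_const r)
    show ?case by (rule exI[of _ "\<lambda>_ _. 0"]) (auto intro: homog_zero has_dirderiv_const)
  next
    case (homog_zero d)
    show ?case by (rule exI[of _ "\<lambda>_ _. 0"]) (auto intro: homog.homog_zero has_dirderiv_const)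
  next
    case (homog_lin l)
    have "(\<Sum>i\<in>UNIV. y $ i * l $ i) = l \<bullet> y" for y :: "real ^ 'n" by (simp add: inner_vec_def
          mult.commute)
    then show ?case using homog_const by (intro exI[of _ "\<lambda>i _. l $ i"])
      (auto intro: has_dirderiv_linear)
  next
    case homog_alpha
    have "(\<Sum>i\<in>UNIV. y $ i * ((a $ i \<bullet> y) * (1 / alpha y))) = alpha y" if "y \<noteq> 0" for y
    proof -
      have "(\<Sum>i\<in>UNIV. y $ i * ((a $ i \<bullet> y) * (1 / alpha y))) = (y \<bullet> (a *v y)) / alpha y"
        by (simp add: quad_sum[symmetric] sum_divide_distrib)
      also have "\<dots> = alpha y" using alpha_sq[of y] alpha_pos[OF that] by (simp add: field_simps)
      finally show ?thesis .
    qed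
    then show ?case by (intro exI[of _ "\<lambda>i y. (a $ i \<bullet> y) * (1 / alpha y)"])
       (auto simp del: times_divide_eq_right times_divide_eq_left mult_1_right intro!: has_dirderiv_alpha
             homog_mult'[OF homog_lin homog_inv_alpha])
  next
    case homog_inv_alpha
    define g' where "g' i y = - ((a $ i \<bullet> y) * (1 / alpha y)) * (1 / alpha y) * (1 / alpha y)" for i y
    have "(\<Sum>i\<in>UNIV. y $ i * g' i y) = of_int (- 1) * (1 / alpha y)" if "y \<noteq> 0" for y
    proof -
      have "(\<Sum>i\<in>UNIV. y $ i * g' i y) = - (y \<bullet> (a *v y)) / (alpha y * alpha y * alpha y)"
        by (simp add: g'_def quad_sum[symmetric] sum_divide_distrib sum_negf mult.assoc)
      also have "\<dots> = - (1 / alpha y)" using alpha_pos[OF that] by (simp add: alpha_sq[symmetric])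
      finally show ?thesis by simp
    qed
    moreover have "homog s (- 1 - 1) (g' i)" for i
      unfolding g'_def
      by (intro homog_minus homog_mult'[OF homog_mult'[OF homog_minus[OF homog_mult'[OF homog_lin
            homog.homog_inv_alpha refl]] homog.homog_inv_alpha refl] homog.homog_inv_alpha]) simp
    moreover have "has_dirderiv i (\<lambda>y. 1 / alpha y) y (g' i y)" if "y \<noteq> 0" for i y
      unfolding g'_def using alpha_pos[OF that] by (intro has_dirderiv_inverse has_dirderiv_alpha that) auto
    ultimately show ?case by blast
  next
    case homog_inv_f
    define f' where "f' i y = (a $ i \<bullet> y) * (1 / alpha y) + b $ i" for i y
    have f': "has_dirderiv i f y (f' i y)" if "y \<noteq> 0" for i y
      unfolding f'_def f_def[abs_def] by (intro has_dirderiv_add has_dirderiv_alpha that has_dirderiv_linear)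
    have homog': "homog s 0 (f' i)" for i unfolding f'_def
      by (intro homog_add homog.homog_const homog_mult'[OF homog_lin homog.homog_inv_alpha]) simp
    have "(\<Sum>i\<in>UNIV. y $ i * (- f' i y * (1 / f y) * (1 / f y))) = - (1 / f y)" if "y \<noteq> 0" for y
    proof -
      have "(\<Sum>i\<in>UNIV. y $ i * f' i y) = (y \<bullet> (a *v y)) / alpha y + b \<bullet> y"
        by (simp add: f'_def quad_sum[symmetric] inner_vec_def[of b] sum_divide_distrib sum.distrib
              distrib_left mult.commute)
      also have "\<dots> = f y" using alpha_sq[of y] alpha_pos[OF that] by (simp add: field_simps f_def)
      finally have "(\<Sum>i\<in>UNIV. y $ i * f' i y) = f y" .
      moreover have "(\<Sum>i\<in>UNIV. y $ i * (- f' i y * (1 / f y) * (1 / f y))) = (\<Sum>i\<in>UNIV. y $ i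
            * f' i y) * (- (1 / f y) * (1 / f y))"
        by (simp add: sum_divide_distrib sum_negf)
      ultimately show ?thesis using f_pos[OF that] by (simp add: field_simps)
    qed
    then have "(\<Sum>i\<in>UNIV. y $ i * (- f' i y * (1 / f y) * (1 / f y))) = of_int (- 1) * (1 / f y)" if "y
          \<noteq> 0" for y
      using that by simp
    moreover have "homog s (- 1 - 1) (\<lambda>y. - f' i y * (1 / f y) * (1 / f y))" for i
      using homog_inv_f by (intro homog_mult'[OF homog_mult'[OF homog_minus[OF homog'] homog.homog_inv_f refl]
            homog.homog_inv_f]) auto
    moreover have "has_dirderiv i (\<lambda>y. 1 / f y) y (- f' i y * (1 / f y) * (1 / f y))" if "y \<noteq> 0"
          for i y
      using f_pos[OF that] by (intro has_dirderiv_inverse f' that) auto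
    ultimately show ?case by (intro exI[of _ "\<lambda>i y. - f' i y * (1 / f y) * (1 / f y)"]) blast
  next
    case (homog_add d g h)
    then obtain g' h' where
     g': "\<And>i. homog s (d - 1) (g' i)"
      "\<And>i y. y \<noteq> 0 \<Longrightarrow> has_dirderiv i g y (g' i y)"
      "\<And>y. y \<noteq> 0 \<Longrightarrow> (\<Sum>i\<in>UNIV. y $ i * g' i y) = of_int d * g y" and
     h': "\<And>i. homog s (d - 1) (h' i)"
      "\<And>i y. y \<noteq> 0 \<Longrightarrow> has_dirderiv i h y (h' i y)"
      "\<And>y. y \<noteq> 0 \<Longrightarrow> (\<Sum>i\<in>UNIV. y $ i * h' i y) = of_int d * h y" by blast
    show ?case
      by (intro exI[of _ "\<lambda>i y. g' i y + h' i y"])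
         (use g' h' in \<open>auto intro!: homog.homog_add has_dirderiv_add simp: distrib_left sum.distrib\<close>)
  next
    case (homog_mult d g e h)
    then obtain g' h' where
     g': "\<And>i. homog s (d - 1) (g' i)"
      "\<And>i y. y \<noteq> 0 \<Longrightarrow> has_dirderiv i g y (g' i y)"
      "\<And>y. y \<noteq> 0 \<Longrightarrow> (\<Sum>i\<in>UNIV. y $ i * g' i y) = of_int d * g y" and
     h': "\<And>i. homog s (e - 1) (h' i)"
      "\<And>i y. y \<noteq> 0 \<Longrightarrow> has_dirderiv i h y (h' i y)"
      "\<And>y. y \<noteq> 0 \<Longrightarrow> (\<Sum>i\<in>UNIV. y $ i * h' i y) = of_int e * h y" by blast
    have "(\<Sum>i\<in>UNIV. y $ i * (g' i y * h y + g y * h' i y)) = of_int (d + e) * (g y * h y)" if "y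
          \<noteq> 0" for y
    proof -
      have "(\<Sum>i\<in>UNIV. y $ i * (g' i y * h y + g y * h' i y))
         = (\<Sum>i\<in>UNIV. y $ i * g' i y) * h y + g y * (\<Sum>i\<in>UNIV. y $ i * h' i y)"
        by (simp add: sum_distrib_left sum_distrib_right sum.distrib[symmetric] algebra_simps)
      then show ?thesis using that g' h' by (simp add: algebra_simps)
    qed
    moreover have "homog s (d + e - 1) (\<lambda>y. g' i y * h y + g y * h' i y)" for i
      by (intro homog.homog_add homog_mult'[OF g'(1) homog_mult.hyps(2)] homog_mult'[OF homog_mult.hyps(1)
            h'(1)]) auto
    moreover have "has_dirderiv i (\<lambda>y. g y * h y) y (g' i y * h y + g y * h' i y)" if "y \<noteq> 0" for i y
      using that by (intro has_dirderiv_mult g'(2) h'(2))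
    ultimately show ?case by (intro exI[of _ "\<lambda>i y. g' i y * h y + g y * h' i y"]) blast
  next
    case (homog_cong d g h)
    then obtain g' where
     g': "\<And>i. homog s (d - 1) (g' i)"
      "\<And>i y. y \<noteq> 0 \<Longrightarrow> has_dirderiv i g y (g' i y)"
      "\<And>y. y \<noteq> 0 \<Longrightarrow> (\<Sum>i\<in>UNIV. y $ i * g' i y) = of_int d * g y" by blast
    show ?case using g' homog_cong(2) by (intro exI[of _ g']) (auto simp: has_dirderiv_cong_nonzero[of _ h g])
  qed
  then show ?thesis by (rule *)
qed

lemmas homog_dirderiv = conjunct1[OF homog_deriv_aux]
lemma homog_has_dirderiv: "homog s d g \<Longrightarrow> y \<noteq> 0 \<Longrightarrow> has_dirderiv i g y
      (dirderiv i g y)"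
  and homog_euler: "homog s d g \<Longrightarrow> y \<noteq> 0 \<Longrightarrow> (\<Sum>i\<in>UNIV. y $ i *
        dirderiv i g y) = of_int d * g y"
  using homog_deriv_aux by blast+

lemma dirderiv_add_homog: "homog s d g \<Longrightarrow> homog s e h \<Longrightarrow> y \<noteq> 0 \<Longrightarrow>
    dirderiv i (\<lambda>y. g y + h y) y = dirderiv i g y + dirderiv i h y"
  by (intro dirderivI has_dirderiv_add homog_has_dirderiv)

lemma dirderiv_mult_homog: "homog s d g \<Longrightarrow> homog s e h \<Longrightarrow> y \<noteq> 0 \<Longrightarrow>
    dirderiv i (\<lambda>y. g y * h y) y = dirderiv i g y * h y + g y * dirderiv i h y"
  by (intro dirderivI has_dirderiv_mult homog_has_dirderiv)

lemma dirderiv_scale_homog: "homog s d g \<Longrightarrow> y \<noteq> 0 \<Longrightarrow> dirderiv i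
      (\<lambda>y. r * g y) y = r * dirderiv i g y"
  using dirderiv_mult_homog[OF homog_const, of s d g y i r] dirderivI[OF has_dirderiv_const] by fastforce

lemma dirderiv_diff_homog: "homog s d g \<Longrightarrow> homog s e h \<Longrightarrow> y \<noteq> 0 \<Longrightarrow>
    dirderiv i (\<lambda>y. g y - h y) y = dirderiv i g y - dirderiv i h y"
  using dirderiv_add_homog[of s d g e "\<lambda>y. (-1) * h y"] dirderiv_scale_homog[of s e h y i "-1"]
    homog_scale[of s e h "-1"] by simp

lemma dirderiv_sum_homog: "(\<And>j. j \<in> J \<Longrightarrow> homog s d (g j)) \<Longrightarrow> y \<noteq>
      0 \<Longrightarrow>
    dirderiv i (\<lambda>y. \<Sum>j\<in>J. g j y) y = (\<Sum>j\<in>J. dirderiv i (g j) y)"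
  by (intro dirderivI has_dirderiv_sum homog_has_dirderiv)

lemma dirderiv_coord:
  fixes y :: "real ^ 'n"
  shows "dirderiv i (\<lambda>y. y $ j) y = (if j = i then 1 else 0)"
proof -
  have "(\<lambda>y :: real ^ 'n. y $ j) = (\<lambda>y. axis j 1 \<bullet> y)" by (simp add: inner_axis')
  then show ?thesis using dirderivI[OF has_dirderiv_linear[of i "axis j 1" y]] by (simp add: axis_def eq_commute)
qed

text \<open>Euler's identity differentiated along axis \<open>j\<close>. It contracts the inner
  index of the second derivative, whereas \<open>homog_euler\<close> applied to a first derivative
  contracts the outer one; with both at hand, symmetry of second derivatives need not be
  invoked.\<close>

lemma dirderiv_second_euler:
  assumes "homog s d g" "y \<noteq> 0"
  shows "(\<Sum>i\<in>UNIV. y $ i * dirderiv j (dirderiv i g) y) = (of_int d - 1) * dirderiv j g y"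
proof -
  have "dirderiv j (\<lambda>y. \<Sum>i\<in>UNIV. y $ i * dirderiv i g y) y = dirderiv j (\<lambda>y. of_int d
        * g y) y"
    by (rule dirderiv_cong_nonzero) (use assms homog_euler in auto)
  also have "\<dots> = of_int d * dirderiv j g y" by (rule dirderiv_scale_homog[OF assms])
  also have "dirderiv j (\<lambda>y. \<Sum>i\<in>UNIV. y $ i * dirderiv i g y) y
    = (\<Sum>i\<in>UNIV. dirderiv j (\<lambda>y. y $ i * dirderiv i g y) y)"
    by (rule dirderiv_sum_homog[where s=s]) (use assms in \<open>auto intro!: homog_mult'[OF homog_coord
          homog_dirderiv]\<close>)
  also have "\<dots> = (\<Sum>i\<in>UNIV. (if i = j then 1 else 0) * dirderiv i g y + y $ i * dirderiv j
        (dirderiv i g) y)"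
    by (rule sum.cong) (auto simp: dirderiv_mult_homog[OF homog_coord homog_dirderiv[OF assms(1)] assms(2)]
          dirderiv_coord)
  also have "\<dots> = dirderiv j g y + (\<Sum>i\<in>UNIV. y $ i * dirderiv j (dirderiv i g) y)"
    by (simp only: sum.distrib) (simp add: mult_delta_left)
  finally show ?thesis by (simp add: algebra_simps)
qed

section \<open>Gradient, fundamental tensor and inverse fundamental tensor in closed form\<close>

definition grad :: "real ^ 'n \<Rightarrow> real ^ 'n" where
  "grad y = (1 / alpha y) *\<^sub>R (a *v y) + b"

lemma dirderiv_f: "y \<noteq> 0 \<Longrightarrow> dirderiv i f y = grad y $ i"
  unfolding grad_def f_def[abs_def]
  by (rule dirderivI, rule has_dirderiv_add[OF has_dirderiv_alpha has_dirderiv_linear, THEN back_subst[of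
        "has_dirderiv i _ y"]])
     (auto simp: matrix_vector_mul_component)

lemma beta_eq: "b \<bullet> y = f y - alpha y" by (simp add: f_def)

lemma grad_radial: "y \<noteq> 0 \<Longrightarrow> y \<bullet> grad y = f y"
  using alpha_sq[of y] alpha_pos[of y] by (simp add: grad_def inner_add_right f_def inner_commute field_simps)

lemma b_sharp_b: "b \<bullet> b_sharp = 1 - defect" "b_sharp \<bullet> b = 1 - defect" by (simp_all add:
      defect_def inner_commute)

lemma a_inv_grad: "y \<noteq> 0 \<Longrightarrow> (a_inv *v k) \<bullet> grad y = (k \<bullet> y) / alpha y +
      b_sharp \<bullet> k"
  using a_inner[of "a_inv *v k" y] a_inv_inner[of k b]
  by (simp add: grad_def inner_add_right b_sharp_def inner_commute[of _ k])

text \<open>The left side is \<open>b \<bullet> y + alpha y * (b \<bullet> b_sharp)\<close>. Here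
  and in \<open>a_inv_grad_grad\<close> the value at \<open>f = 0\<close> is
  \<open>- defect * alpha\<close>, and this is how \<open>defect\<close> enters the pole of the
  scalar curvature.\<close>

lemma b_sharp_grad: "y \<noteq> 0 \<Longrightarrow> alpha y * (b_sharp \<bullet> grad y) = f y - defect * alpha y"
  using alpha_pos[of y] by (simp add: b_sharp_def a_inv_grad beta_eq) (simp add: b_sharp_def[symmetric]
        b_sharp_b field_simps)

lemma a_inv_grad_grad: "y \<noteq> 0 \<Longrightarrow> alpha y * ((a_inv *v grad y) \<bullet> grad y) = 2 * f y
      - defect * alpha y"
proof -
  assume y: "y \<noteq> 0"
  have "a_inv *v grad y = (1 / alpha y) *\<^sub>R y + b_sharp"
    by (simp add: grad_def matrix_vector_right_distrib matrix_vector_mult_scaleR b_sharp_def)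
  then have "alpha y * ((a_inv *v grad y) \<bullet> grad y) = y \<bullet> grad y + alpha y * (b_sharp \<bullet>
        grad y)"
    using alpha_pos[OF y] by (simp add: inner_add_left field_simps)
  then show ?thesis using grad_radial[OF y] b_sharp_grad[OF y] by simp
qed

text \<open>The classical inverse fundamental tensor of a Randers norm. The last numerator is
  \<open>\<beta> + |b|^2 \<alpha>\<close>, written so that its value at \<open>f = 0\<close> is
  visible.\<close>

definition ginv :: "real ^ 'n \<Rightarrow> real ^ 'n ^ 'n" where
  "ginv y = (\<chi> k l. alpha y / f y * a_inv $ k $ l - alpha y / (f y)\<^sup>2 * (b_sharp $ k * y $ l + y $ k
        * b_sharp $ l)
     + (f y - defect * alpha y) / (f y) ^ 3 * (y $ k * y $ l))"

text \<open>The fundamental tensor \<open>f f_ij + f_i f_j\<close>, with the Hessian of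
  \<open>f\<close>, which is that of \<open>alpha\<close>, written out.\<close>

definition gmat :: "real ^ 'n \<Rightarrow> real ^ 'n ^ 'n" where
  "gmat y = (\<chi> i j. f y / alpha y * (a $ i $ j - (a *v y) $ i * (a *v y) $ j / (alpha y)\<^sup>2) + grad y
        $ i * grad y $ j)"

lemma ginv_mult: "ginv y *v k = (alpha y / f y) *\<^sub>R (a_inv *v k)
   - (alpha y / (f y)\<^sup>2) *\<^sub>R ((k \<bullet> y) *\<^sub>R b_sharp + (b_sharp \<bullet> k) *\<^sub>R
         y) + ((f y - defect * alpha y) / (f y) ^ 3 * (k \<bullet> y)) *\<^sub>R y"
proof -
  have "(\<Sum>j\<in>UNIV. (p * m j - q * (u * y $ j + v * b_sharp $ j) + r * (v * y $ j)) * k $ j) =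
     p * (\<Sum>j\<in>UNIV. m j * k $ j) - q * ((k \<bullet> y) * u + (b_sharp \<bullet> k) * v) + (r * (k
           \<bullet> y)) * v"
    for p q r u v and m :: "'n \<Rightarrow> real"
    by (simp add: inner_vec_def sum_distrib_left sum_distrib_right sum.distrib sum_subtractf algebra_simps)
  then show ?thesis
    by (simp add: vec_eq_iff ginv_def matrix_vector_mult_def del: times_divide_eq_left times_divide_eq_right)
qed

lemma gmat_mult: "gmat y *v w = (f y / alpha y) *\<^sub>R (a *v w - (1 / (alpha y)\<^sup>2 * ((a *v y)
      \<bullet> w)) *\<^sub>R (a *v y)) + (grad y \<bullet> w) *\<^sub>R grad y"
proof -
  have "(\<Sum>j\<in>UNIV. (p * (m j - u * v $ j / q) + t * z $ j) * w $ j) =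
     p * ((\<Sum>j\<in>UNIV. m j * w $ j) - (1 / q * (v \<bullet> w)) * u) + (z \<bullet> w) * t"
    for p q t u and v z :: "real ^ 'n" and m :: "'n \<Rightarrow> real"
    by (simp add: inner_vec_def sum_distrib_left sum_distrib_right sum.distrib sum_subtractf sum_divide_distrib
          algebra_simps)
  note * = this[of "f y / alpha y" _ _ _ "(alpha y)\<^sup>2"]
  show ?thesis
    by (simp add: * vec_eq_iff gmat_def matrix_vector_mult_def[of "vec_lambda _"] matrix_vector_mult_def[of a
          w] del: times_divide_eq_left times_divide_eq_right)
qed

text \<open>Both matrices are a multiple of \<open>a\<close> or \<open>a_inv\<close> plus terms of
  low rank, so applying the product to \<open>k\<close> gives a combination of \<open>k\<close>,
  \<open>b\<close> and \<open>a *v y\<close>. The two \<open>b\<close> terms cancel because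
  \<open>grad y \<bullet> w = (k \<bullet> y) / f y\<close>.\<close>

lemma gmat_ginv:
  assumes "y \<noteq> 0"
  shows "gmat y ** ginv y = mat 1"
proof -
  have alpha: "alpha y \<noteq> 0" and f: "f y \<noteq> 0" using alpha_pos[OF assms] f_pos[OF assms] by auto
  have "gmat y *v (ginv y *v k) = k" for k
  proof -
    define w where "w = ginv y *v k"
    define t where "t = k \<bullet> y"
    define u where "u = b_sharp \<bullet> k"
    have ips: "y \<bullet> k = t" "y \<bullet> b = f y - alpha y" "b \<bullet> y = f y - alpha y" "y \<bullet>
          (a *v y) = (alpha y)\<^sup>2" "b \<bullet> (a_inv *v k) = u"
      by (auto simp: t_def u_def beta_eq[symmetric] alpha_sq power2_eq_square b_sharp_def a_inv_inner
            inner_commute[of y])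
    have aw: "a *v w = (alpha y / f y) *\<^sub>R k - (alpha y / (f y)\<^sup>2) *\<^sub>R (t *\<^sub>R b + u
          *\<^sub>R (a *v y))
        + ((f y - defect * alpha y) / (f y) ^ 3 * t) *\<^sub>R (a *v y)"
      by (simp add: w_def ginv_mult matrix_vector_right_distrib matrix_vector_mult_diff_distrib
            matrix_vector_mult_scaleR
          b_sharp_def t_def u_def)
    have ayw: "(a *v y) \<bullet> w = alpha y / f y * t - alpha y / (f y)\<^sup>2 * (t * (f y - alpha y) + u *
          (alpha y)\<^sup>2)
        + (f y - defect * alpha y) / (f y) ^ 3 * t * (alpha y)\<^sup>2"
      by (simp only: a_inner[symmetric] aw)
         (simp add: inner_add_right inner_diff_right ips)
    have bw: "b \<bullet> w = alpha y / f y * u - alpha y / (f y)\<^sup>2 * (t * (1 - defect) + u * (f y - alpha y))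
        + (f y - defect * alpha y) / (f y) ^ 3 * t * (f y - alpha y)"
      by (simp add: w_def ginv_mult inner_add_right inner_diff_right b_sharp_b ips t_def[symmetric] u_def[symmetric])
    have dfw: "grad y \<bullet> w = t / f y"
      by (simp add: grad_def inner_add_left ayw bw) (use alpha f in \<open>simp add: field_simps
            power2_eq_square power3_eq_cube\<close>)
    \<comment> \<open>The left side is the total coefficient of \<open>a *v y\<close> in
      \<open>gmat y *v w\<close>.\<close>
    have coef: "f y / alpha y * (- alpha y / (f y)\<^sup>2 * u + (f y - defect * alpha y) / (f y) ^ 3 * t - 1 /
          (alpha y)\<^sup>2 * ((a *v y) \<bullet> w)) + t / (f y * alpha y) = 0"
      unfolding ayw using alpha f by (simp add: field_simps power2_eq_square power3_eq_cube)
    have "gmat y *v w = k + (f y / alpha y * (- alpha y / (f y)\<^sup>2 * u + (f y - defect * alpha y) / (f y)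
          ^ 3 * t - 1 / (alpha y)\<^sup>2 * ((a *v y) \<bullet> w)) + t / (f y * alpha y)) *\<^sub>R (a *v y)"
    proof -
      have "f y / alpha y * (alpha y / f y * k' - alpha y / (f y)\<^sup>2 * (t * b' + u * z) + r * z - 1 /
            (alpha y)\<^sup>2 * x * z) + t / f y * (1 / alpha y * z + b')
        = k' + (f y / alpha y * (- alpha y / (f y)\<^sup>2 * u + r - 1 / (alpha y)\<^sup>2 * x) + t / (f y *
              alpha y)) * z" for k' b' z r x
        using alpha f by (simp add: field_simps power2_eq_square)
      then show ?thesis
        unfolding gmat_mult dfw aw unfolding grad_def
        by (simp add: vec_eq_iff del: times_divide_eq_left times_divide_eq_right)
    qed
    then show ?thesis unfolding coef by (simp add: w_def)
  qed
  then show ?thesis by (simp add: matrix_eq matrix_vector_mul_assoc[symmetric])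
qed

text \<open>The identity \<open>g_ij y^j = f f_i\<close> solved for \<open>y\<close>; it is the
  source of the term \<open>(k \<bullet> y) y\<close> in the spray.\<close>

lemma ginv_grad:
  assumes "y \<noteq> 0"
  shows "ginv y *v grad y = (1 / f y) *\<^sub>R y"
proof -
  have alpha: "alpha y \<noteq> 0" and f: "f y \<noteq> 0" using alpha_pos[OF assms] f_pos[OF assms] by auto
  have 1: "a_inv *v grad y = (1 / alpha y) *\<^sub>R y + b_sharp"
    by (simp add: grad_def matrix_vector_right_distrib matrix_vector_mult_scaleR b_sharp_def)
  have 2: "b_sharp \<bullet> grad y = (f y - defect * alpha y) / alpha y" using b_sharp_grad[OF assms] alpha by
        (simp add: field_simps)
  show ?thesis unfolding ginv_mult 1 2 using alpha f grad_radial[OF assms]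
    by (simp add: vec_eq_iff inner_commute) (simp add: field_simps power2_eq_square power3_eq_cube)
qed

lemma dirderiv2_f_sq:
  assumes "y \<noteq> 0"
  shows "dirderiv j (dirderiv i (\<lambda>y. (f y)\<^sup>2)) y = 2 * gmat y $ i $ j"
proof -
  have alpha: "alpha y \<noteq> 0" and f: "f y \<noteq> 0" using alpha_pos[OF assms] f_pos[OF assms] by auto
  have 1: "dirderiv i (\<lambda>y. (f y)\<^sup>2) y = 2 * (f y * dirderiv i f y)" if "y \<noteq> 0" for y
    unfolding power2_eq_square using dirderiv_mult_homog[OF homog_f homog_f that] by simp
  have alpha': "dirderiv i alpha y = (a $ i \<bullet> y) * (1 / alpha y)" if "y \<noteq> 0" for i y
    using that by (intro dirderivI has_dirderiv_alpha)
  have "has_dirderiv j (\<lambda>y. (a $ i \<bullet> y) * (1 / alpha y) + b $ i) y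
     (((a $ i $ j) * (1 / alpha y) + (a $ i \<bullet> y) * (- ((a $ j \<bullet> y) * (1 / alpha y)) * (1 /
           alpha y) * (1 / alpha y))) + 0)"
    by (intro has_dirderiv_add has_dirderiv_mult has_dirderiv_linear has_dirderiv_inverse has_dirderiv_const
          has_dirderiv_alpha assms alpha)
  then have 2: "dirderiv j (\<lambda>y. (a $ i \<bullet> y) * (1 / alpha y) + b $ i) y =
     (((a $ i $ j) * (1 / alpha y) + (a $ i \<bullet> y) * (- ((a $ j \<bullet> y) * (1 / alpha y)) * (1 /
           alpha y) * (1 / alpha y))) + 0)"
    by (rule dirderivI)
  have 3: "dirderiv j (dirderiv i f) y = dirderiv j (\<lambda>y. (a $ i \<bullet> y) * (1 / alpha y) + b $ i) y"
    by (rule dirderiv_cong_nonzero[OF assms]) (simp add: dirderiv_f grad_def matrix_vector_mul_component)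
  have "dirderiv j (dirderiv i (\<lambda>y. (f y)\<^sup>2)) y = dirderiv j (\<lambda>y. 2 * (f y * dirderiv i f y)) y"
    by (rule dirderiv_cong_nonzero[OF assms 1])
  also have "\<dots> = 2 * (dirderiv j f y * dirderiv i f y + f y * dirderiv j (dirderiv i f) y)"
    using dirderiv_scale_homog[OF homog_mult[OF homog_f homog_dirderiv[OF homog_f]] assms]
          dirderiv_mult_homog[OF homog_f homog_dirderiv[OF homog_f] assms] by metis
  also have "\<dots> = 2 * gmat y $ i $ j"
    unfolding 3 2 using assms alpha
    by (simp add: dirderiv_f gmat_def matrix_vector_mul_component field_simps power2_eq_square)
  finally show ?thesis .
qed

end

section \<open>The pole of the curvature along the zeros of the norm\<close>

text \<open>The trace of the square of the Jacobian of \<open>P y - A\<close>, with \<open>x\<close>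
  the gradient of \<open>P\<close> and \<open>B\<close> the derivatives of \<open>A\<close>; the
  hypotheses are Euler's identities in degrees 1 and 2. In \<open>n + 3\<close>, \<open>n\<close> is
  the trace of the identity, 1 comes from \<open>(x \<bullet> y)^2\<close> and 2 from the cross term
  with the identity.\<close>

lemma spray_square_trace:
  fixes x y A :: "'n::finite \<Rightarrow> real" and B :: "'n \<Rightarrow> 'n \<Rightarrow> real"
  assumes xy: "(\<Sum>j\<in>UNIV. x j * y j) = P" and yB: "\<And>m. (\<Sum>j\<in>UNIV. y j * B j m) = 2 * A m"
  shows "(\<Sum>m\<in>UNIV. \<Sum>j\<in>UNIV. (x j * y m + P * (if m = j then 1 else 0) - B j m) * (x m * y j +
        P * (if j = m then 1 else 0) - B m j))
    = (real CARD('n) + 3) * P\<^sup>2 - 4 * (\<Sum>j\<in>UNIV. A j * x j) - 2 * P * (\<Sum>m\<in>UNIV. B m m) +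
          (\<Sum>m\<in>UNIV. \<Sum>j\<in>UNIV. B j m * B m j)"
proof -
  have "(x j * y m + P * (if m = j then 1 else 0) - B j m) * (x m * y j + P * (if j = m then 1 else 0) - B m j)
     = (x m * y m) * (x j * y j) - y m * (x j * B m j) - x m * (y j * B j m) + B j m * B m j
       + (if j = m then P\<^sup>2 + 2 * P * (x m * y m) - 2 * P * B m m else 0)" for j m
    by (simp add: algebra_simps power2_eq_square)
  then have "(\<Sum>m\<in>UNIV. \<Sum>j\<in>UNIV. (x j * y m + P * (if m = j then 1 else 0) - B j m) * (x m * y
        j + P * (if j = m then 1 else 0) - B m j))
    = (\<Sum>m\<in>UNIV. (x m * y m) * P - (\<Sum>j\<in>UNIV. y m * (x j * B m j)) - x m * (2 * A m) +
          (\<Sum>j\<in>UNIV. B j m * B m j)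
       + (P\<^sup>2 + 2 * P * (x m * y m) - 2 * P * B m m))"
    by (simp add: sum.distrib sum_subtractf xy yB sum_distrib_left[symmetric])
  also have "\<dots> = (\<Sum>m\<in>UNIV. x m * y m) * P - (\<Sum>m\<in>UNIV. \<Sum>j\<in>UNIV. y m * (x j * B
        m j)) - 2 * (\<Sum>j\<in>UNIV. A j * x j)
      + (\<Sum>m\<in>UNIV. \<Sum>j\<in>UNIV. B j m * B m j) + (real CARD('n) * P\<^sup>2 + 2 * P *
            (\<Sum>m\<in>UNIV. x m * y m) - 2 * P * (\<Sum>m\<in>UNIV. B m m))"
    by (simp only: sum.distrib sum_subtractf) (simp add: sum_distrib_left sum_distrib_right mult_ac)
  also have "(\<Sum>m\<in>UNIV. \<Sum>j\<in>UNIV. y m * (x j * B m j)) = (\<Sum>j\<in>UNIV. \<Sum>m\<in>UNIV. y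
        m * (x j * B m j))"
    by (rule sum.swap)
  also have "\<dots> = (\<Sum>j\<in>UNIV. x j * (\<Sum>m\<in>UNIV. y m * B m j))"
    by (simp add: sum_distrib_left mult_ac)
  also have "\<dots> = 2 * (\<Sum>j\<in>UNIV. A j * x j)" by (simp add: yB sum_distrib_left mult_ac)
  finally show ?thesis unfolding xy by (simp add: algebra_simps power2_eq_square)
qed

context randers_norm
begin

text \<open>\<open>spray k\<close> is \<open>(k \<bullet> y) y^i - f\<^sup>2 / 2 * ginv^{il} k_l\<close>, the
      spray of \<open>exp \<kappa> * f\<close> for \<open>d\<kappa> = k\<close>. The
  splitting isolates the pole in the coefficient \<open>proj_factor = proj_num / f\<close> of
        \<open>y\<close>.\<close>

definition proj_num :: "real ^ 'n \<Rightarrow> real ^ 'n \<Rightarrow> real" where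
  "proj_num k y = (f y + defect * alpha y) * (k \<bullet> y) / 2"
definition spray_rest :: "real ^ 'n \<Rightarrow> 'n \<Rightarrow> real ^ 'n \<Rightarrow> real" where
  "spray_rest k i y = (f y * alpha y * (a_inv *v k) $ i - alpha y * (b_sharp $ i * (k \<bullet> y) + (b_sharp
        \<bullet> k) * y $ i)) / 2"
definition proj_factor :: "real ^ 'n \<Rightarrow> real ^ 'n \<Rightarrow> real" where
  "proj_factor k y = proj_num k y * (1 / f y)"
definition spray :: "real ^ 'n \<Rightarrow> 'n \<Rightarrow> real ^ 'n \<Rightarrow> real" where
  "spray k i y = proj_factor k y * y $ i - spray_rest k i y"

lemma homog_proj_num: "homog s 2 (proj_num k)"
  unfolding proj_num_def[abs_def]
  by (intro homog_divide homog_mult'[OF homog_add[OF homog_f homog_scale[OF homog_alpha]] homog_lin]) simp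
lemma homog_spray_rest: "homog s 2 (spray_rest k i)"
  unfolding spray_rest_def[abs_def]
  by (intro homog_divide homog_diff homog_scale_right homog_mult'[OF homog_f homog_alpha]
    homog_mult'[OF homog_alpha homog_add[OF homog_scale[OF homog_lin] homog_scale[OF homog_coord]]]) auto
lemma homog_proj_factor: "homog True 1 (proj_factor k)"
  unfolding proj_factor_def[abs_def] by (intro homog_mult'[OF homog_proj_num homog_inv_f]) auto
lemma homog_spray: "homog True 2 (spray k i)"
  unfolding spray_def[abs_def] by (intro homog_diff homog_spray_rest homog_mult'[OF homog_proj_factor
        homog_coord]) auto

text \<open>The product rule for \<open>proj_num = proj_factor * f\<close>, kept free of
  denominators. The gradient of the simple pole has a double pole with coefficient
  \<open>- proj_num * grad\<close>.\<close>

lemma dirderiv_proj_factor: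
  assumes "y \<noteq> 0"
  shows "(f y)\<^sup>2 * dirderiv j (proj_factor k) y = f y * dirderiv j (proj_num k) y - proj_num k y * grad y $ j"
proof -
  have "dirderiv j (proj_num k) y = dirderiv j (\<lambda>y. proj_factor k y * f y) y"
    by (rule dirderiv_cong_nonzero[OF assms]) (use f_pos in \<open>force simp: proj_factor_def\<close>)
  also have "\<dots> = dirderiv j (proj_factor k) y * f y + proj_factor k y * grad y $ j"
    using dirderiv_mult_homog[OF homog_proj_factor homog_f assms] dirderiv_f[OF assms] by simp
  finally show ?thesis using f_pos[OF assms] by (simp add: proj_factor_def power2_eq_square algebra_simps)
qed

lemma dirderiv_spray:
  assumes "y \<noteq> 0"
  shows "dirderiv j (spray k i) y = dirderiv j (proj_factor k) y * y $ i + proj_factor k y * (if i = j then 1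
        else 0) - dirderiv j (spray_rest k i) y"
  unfolding spray_def[abs_def]
  using dirderiv_diff_homog[OF homog_mult[OF homog_proj_factor homog_coord] homog_spray_rest assms]
        dirderiv_mult_homog[OF homog_proj_factor homog_coord assms]
  by (simp add: dirderiv_coord)

lemma dirderiv2_spray:
  assumes "y \<noteq> 0"
  shows "dirderiv m (dirderiv j (spray k i)) y = dirderiv m (dirderiv j (proj_factor k)) y * y $ i + dirderiv j
        (proj_factor k) y * (if i = m then 1 else 0)
    + dirderiv m (proj_factor k) y * (if i = j then 1 else 0) - dirderiv m (dirderiv j (spray_rest k i)) y"
proof -
  have "dirderiv m (dirderiv j (spray k i)) y = dirderiv m (\<lambda>y. (dirderiv j (proj_factor k) y * y $ i +
        (if i = j then 1 else 0) * proj_factor k y) - dirderiv j (spray_rest k i) y) y"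
    by (rule dirderiv_cong_nonzero[OF assms]) (simp add: dirderiv_spray)
  also have "\<dots> = dirderiv m (\<lambda>y. dirderiv j (proj_factor k) y * y $ i + (if i = j then 1 else 0)
        * proj_factor k y) y - dirderiv m (dirderiv j (spray_rest k i)) y"
    by (rule dirderiv_diff_homog[OF homog_add[OF homog_mult'[OF homog_dirderiv[OF homog_proj_factor]
          homog_coord] homog_scale[OF homog_proj_factor]] homog_dirderiv[OF homog_spray_rest] assms]) simp
  also have "dirderiv m (\<lambda>y. dirderiv j (proj_factor k) y * y $ i + (if i = j then 1 else 0) *
        proj_factor k y) y
    = dirderiv m (\<lambda>y. dirderiv j (proj_factor k) y * y $ i) y + dirderiv m (\<lambda>y. (if i = j then
          1 else 0) * proj_factor k y) y"
    by (rule dirderiv_add_homog[OF homog_mult[OF homog_dirderiv[OF homog_proj_factor] homog_coord]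
          homog_scale[OF homog_proj_factor] assms])
  finally show ?thesis
    unfolding dirderiv_mult_homog[OF homog_dirderiv[OF homog_proj_factor] homog_coord assms]
          dirderiv_scale_homog[OF homog_proj_factor assms]
    by (simp add: dirderiv_coord)
qed

lemma div_spray:
  assumes "y \<noteq> 0"
  shows "(\<Sum>m\<in>UNIV. dirderiv m (spray k m) y) = (real CARD('n) + 1) * proj_factor k y -
        (\<Sum>m\<in>UNIV. dirderiv m (spray_rest k m) y)"
  using homog_euler[OF homog_proj_factor assms, of k] assms
  by (simp add: dirderiv_spray sum.distrib sum_subtractf mult.commute algebra_simps)

text \<open>The derivatives of \<open>proj_factor\<close> have degree 0, so their radial derivative
  vanishes. The Kronecker terms contribute \<open>n\<close> and 1.\<close>

lemma div_dirderiv_spray: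
  assumes "y \<noteq> 0"
  shows "(\<Sum>m\<in>UNIV. dirderiv m (dirderiv j (spray k m)) y) = (real CARD('n) + 1) * dirderiv j
        (proj_factor k) y - (\<Sum>m\<in>UNIV. dirderiv m (dirderiv j (spray_rest k m)) y)"
proof -
  have "(\<Sum>m\<in>UNIV. dirderiv m (proj_factor k) y * (if m = j then 1 else 0)) = dirderiv j (proj_factor k) y"
    by (simp add: mult_delta_right)
  then show ?thesis
    using homog_euler[OF homog_dirderiv[OF homog_proj_factor] assms, of j k] assms
    by (simp add: dirderiv2_spray sum.distrib sum_subtractf mult.commute algebra_simps)
qed

text \<open>\<open>k\<close> stands for \<open>d\<kappa>\<close> and \<open>H j\<close> for its derivative
      along the \<open>j\<close>-th axis; the spray being linear in
  \<open>d\<kappa>\<close>, its position derivatives are \<open>spray (H j)\<close>.\<close>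

definition ric :: "real ^ 'n \<Rightarrow> ('n \<Rightarrow> real ^ 'n) \<Rightarrow> real ^ 'n \<Rightarrow>
      real" where
  "ric k H y = (\<Sum>m\<in>UNIV. 2 * spray (H m) m y - (\<Sum>j\<in>UNIV. dirderiv m (spray (H j) m) y * y $ j)
      + 2 * (\<Sum>j\<in>UNIV. spray k j y * dirderiv m (dirderiv j (spray k m)) y)
      - (\<Sum>j\<in>UNIV. dirderiv j (spray k m) y * dirderiv m (spray k j) y))"

lemma homog_ric: "homog True 2 (ric k H)"
  unfolding ric_def[abs_def]
  by (intro homog_sum finite homog_diff homog_add homog_scale homog_spray
     homog_mult'[OF homog_dirderiv[OF homog_spray] homog_coord] homog_mult'[OF homog_dirderiv[OF homog_spray]
           homog_dirderiv[OF homog_spray]]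
     homog_mult'[OF homog_spray homog_dirderiv[OF homog_dirderiv[OF homog_spray]]]) auto

text \<open>The value is \<open>proj_num k y - f y * (k \<bullet> y) / 2\<close>, hence equal to
  \<open>proj_num\<close> at the zeros of \<open>f\<close>. So in the Ricci curvature the derivative
  of \<open>proj_factor\<close> along \<open>spray_rest\<close> contributes a multiple of the same
  square as \<open>proj_factor\<close> itself.\<close>

lemma spray_rest_grad:
  assumes "y \<noteq> 0"
  shows "(\<Sum>j\<in>UNIV. spray_rest k j y * grad y $ j) = defect * alpha y * (k \<bullet> y) / 2"
proof -
  have alpha: "alpha y \<noteq> 0" using alpha_pos[OF assms] by auto
  have "(\<Sum>j\<in>UNIV. spray_rest k j y * grad y $ j) = (f y * alpha y * ((a_inv *v k) \<bullet> grad y) -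
        alpha y * ((b_sharp \<bullet> grad y) * (k \<bullet> y) + (b_sharp \<bullet> k) * (y \<bullet> grad y))) / 2"
    by (simp add: spray_rest_def inner_vec_def[of "a_inv *v k"] inner_vec_def[of b_sharp "grad y"] inner_vec_def[of y]
         sum_distrib_left sum_distrib_right sum_divide_distrib sum.distrib[symmetric] sum_subtractf[symmetric]
               algebra_simps diff_divide_distrib add_divide_distrib)
  also have "\<dots> = (f y * (k \<bullet> y) - (alpha y * (b_sharp \<bullet> grad y)) * (k \<bullet> y)) / 2"
    unfolding a_inv_grad[OF assms] grad_radial[OF assms] using alpha by (simp add: field_simps)
  finally show ?thesis unfolding b_sharp_grad[OF assms] by (simp add: algebra_simps)
qed

text \<open>At \<open>f = 0\<close> one has
  \<open>proj_num = defect * alpha * (k \<bullet> y) / 2\<close>. Its square occurs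
  \<open>n - 1\<close> times from the square of \<open>proj_factor\<close> and
  \<open>2 (n - 1)\<close> times from the derivative along \<open>spray_rest\<close>; together this
  is \<open>3 (n - 1) / 4\<close> of the displayed square.\<close>

definition ric_lead :: "real ^ 'n \<Rightarrow> real ^ 'n \<Rightarrow> real" where
  "ric_lead k y = 3 / 4 * (real CARD('n) - 1) * (defect * alpha y * (k \<bullet> y))\<^sup>2"

text \<open>The terms with \<open>H\<close> are linear in the spray and have at most a simple pole.
  Thus the second derivatives of the conformal factor disappear into \<open>q\<close>, and the
  leading term depends on \<open>k\<close> alone.\<close>

lemma ric_pole:
  "\<exists>q. homog False 3 q \<and> (\<forall>y. y \<noteq> 0 \<longrightarrow> (f y)\<^sup>2 * ric k H y =
        ric_lead k y + f y * q y)"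
proof -
  let ?n = "real CARD('n)"
  define s1 where "s1 y = (\<Sum>m\<in>UNIV. proj_num (H m) y * y $ m - f y * spray_rest (H m) m y)" for y
  define s2 where "s2 y = (\<Sum>j\<in>UNIV. y $ j * ((?n + 1) * proj_num (H j) y - f y * (\<Sum>m\<in>UNIV.
        dirderiv m (spray_rest (H j) m) y)))" for y
  define ap where "ap y = (\<Sum>j\<in>UNIV. spray_rest k j y * dirderiv j (proj_num k) y)" for y
  define ax where "ax y = (\<Sum>j\<in>UNIV. spray_rest k j y * dirderiv j (proj_factor k) y)" for y
  define B where "B j y = (\<Sum>m\<in>UNIV. dirderiv m (dirderiv j (spray_rest k m)) y)" for j y
  define yB where "yB y = (\<Sum>j\<in>UNIV. y $ j * B j y)" for y
  define aB where "aB y = (\<Sum>j\<in>UNIV. spray_rest k j y * B j y)" for y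
  define dA where "dA y = (\<Sum>m\<in>UNIV. dirderiv m (spray_rest k m) y)" for y
  define tt where "tt y = (\<Sum>m\<in>UNIV. \<Sum>j\<in>UNIV. dirderiv j (spray_rest k m) y * dirderiv m
        (spray_rest k j) y)" for y
  \<comment> \<open>Read off from the collection of terms at the end. The first summand is what
    remains of \<open>proj_num * (proj_num + defect * alpha * (k \<bullet> y))\<close> once its
    value at \<open>f = 0\<close> is split off and one factor \<open>f\<close> is removed.\<close>
  define q where "q y = (?n - 1) / 4 * ((k \<bullet> y)\<^sup>2 * (f y + 4 * defect * alpha y)) - 2 * (?n - 1)
        * ap y + 2 * s1 y - s2 y
     - 2 * (proj_num k y * yB y) + 2 * (f y * aB y) + 2 * (proj_num k y * dA y) - f y * tt y" for y
  have s1: "homog False 3 s1" unfolding s1_def[abs_def]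
    by (intro homog_sum homog_diff finite homog_mult'[OF homog_proj_num homog_coord] homog_mult'[OF homog_f
          homog_spray_rest]) auto
  have s2: "homog False 3 s2" unfolding s2_def[abs_def]
    by (intro homog_sum finite homog_mult'[OF homog_coord homog_diff[OF homog_scale[OF homog_proj_num]
          homog_mult'[OF homog_f homog_sum[OF finite homog_dirderiv[OF homog_spray_rest]]]]]) auto
  have ap: "homog False 3 ap" unfolding ap_def[abs_def]
    by (intro homog_sum finite homog_mult'[OF homog_spray_rest homog_dirderiv[OF homog_proj_num]]) auto
  have B: "homog False 0 (B j)" for j unfolding B_def[abs_def]
    using homog_sum[OF finite, of UNIV False 0 "\<lambda>m. dirderiv m (dirderiv j (spray_rest k m))"]
      homog_dirderiv[OF homog_dirderiv[OF homog_spray_rest]] by simp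
  have yB: "homog False 1 yB" unfolding yB_def[abs_def] by (intro homog_sum finite homog_mult'[OF homog_coord B]) auto
  have aB: "homog False 2 aB" unfolding aB_def[abs_def] by (intro homog_sum finite homog_mult'[OF
        homog_spray_rest B]) auto
  have dA: "homog False 1 dA" unfolding dA_def[abs_def]
    using homog_sum[OF finite, of UNIV False 1 "\<lambda>m. dirderiv m (spray_rest k m)"] homog_dirderiv[OF
          homog_spray_rest] by simp
  have tt: "homog False 2 tt" unfolding tt_def[abs_def]
    by (intro homog_sum finite homog_mult'[OF homog_dirderiv[OF homog_spray_rest] homog_dirderiv[OF
          homog_spray_rest]]) auto
  have q: "homog False 3 q" unfolding q_def[abs_def]
    by (intro homog_add homog_diff homog_scale s1 s2 ap homog_mult'[OF homog_sq[OF homog_lin] homog_add[OF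
          homog_f homog_scale[OF homog_alpha]]]
       homog_mult'[OF homog_proj_num yB] homog_mult'[OF homog_f aB] homog_mult'[OF homog_proj_num dA]
             homog_mult'[OF homog_f tt]) auto
  have "(f y)\<^sup>2 * ric k H y = ric_lead k y + f y * q y" if y: "y \<noteq> 0" for y
  proof -
    have f: "f y \<noteq> 0" using f_pos[OF y] by auto
    define P where "P = proj_factor k y"
    have P: "f y * P = proj_num k y" using f by (simp add: P_def proj_factor_def)
    have fGam: "f y * spray h m y = proj_num h y * y $ m - f y * spray_rest h m y" for h m
      using f by (simp add: spray_def proj_factor_def algebra_simps)
    have S1: "(f y)\<^sup>2 * (\<Sum>m\<in>UNIV. spray (H m) m y) = f y * s1 y"
      by (simp add: s1_def power2_eq_square mult.assoc sum_distrib_left fGam)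
    have "(\<Sum>m\<in>UNIV. \<Sum>j\<in>UNIV. dirderiv m (spray (H j) m) y * y $ j) = (\<Sum>j\<in>UNIV. y $ j
          * (\<Sum>m\<in>UNIV. dirderiv m (spray (H j) m) y))"
      by (subst sum.swap) (simp add: sum_distrib_left mult.commute)
    also have "\<dots> = (\<Sum>j\<in>UNIV. y $ j * ((?n + 1) * proj_factor (H j) y - (\<Sum>m\<in>UNIV.
          dirderiv m (spray_rest (H j) m) y)))"
      by (simp add: div_spray[OF y])
    also have "(f y)\<^sup>2 * \<dots> = (\<Sum>j\<in>UNIV. (f y)\<^sup>2 * (y $ j * ((?n + 1) * proj_factor (H
          j) y - (\<Sum>m\<in>UNIV. dirderiv m (spray_rest (H j) m) y))))"
      by (rule sum_distrib_left)
    also have "\<dots> = (\<Sum>j\<in>UNIV. f y * (y $ j * ((?n + 1) * proj_num (H j) y - f y *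
          (\<Sum>m\<in>UNIV. dirderiv m (spray_rest (H j) m) y))))"
    proof -
      have "(f y)\<^sup>2 * (z * ((?n + 1) * proj_factor h y - d)) = f y * (z * ((?n + 1) * proj_num h y - f y
            * d))" for z h d
        using f by (simp add: proj_factor_def power2_eq_square field_simps)
      then show ?thesis by (intro sum.cong refl)
    qed
    also have "\<dots> = f y * s2 y" unfolding s2_def by (rule sum_distrib_left[symmetric])
    finally have S2: "(f y)\<^sup>2 * (\<Sum>m\<in>UNIV. \<Sum>j\<in>UNIV. dirderiv m (spray (H j) m) y * y $
          j) = f y * s2 y" .
    have xy: "(\<Sum>j\<in>UNIV. dirderiv j (proj_factor k) y * y $ j) = P"
      using homog_euler[OF homog_proj_factor y, of k] by (simp add: P_def mult.commute)
    have "(\<Sum>m\<in>UNIV. \<Sum>j\<in>UNIV. spray k j y * dirderiv m (dirderiv j (spray k m)) y) =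
          (\<Sum>j\<in>UNIV. spray k j y * (\<Sum>m\<in>UNIV. dirderiv m (dirderiv j (spray k m)) y))"
      by (subst sum.swap) (simp add: sum_distrib_left)
    also have "\<dots> = (\<Sum>j\<in>UNIV. (P * y $ j - spray_rest k j y) * ((?n + 1) * dirderiv j
          (proj_factor k) y - B j y))"
      by (simp add: div_dirderiv_spray[OF y] B_def P_def spray_def)
    also have "\<dots> = (?n + 1) * P * (\<Sum>j\<in>UNIV. dirderiv j (proj_factor k) y * y $ j) - P * yB y -
          (?n + 1) * ax y + aB y"
      by (simp add: yB_def ax_def aB_def sum_distrib_left sum.distrib sum_subtractf algebra_simps)
    finally have S3: "(\<Sum>m\<in>UNIV. \<Sum>j\<in>UNIV. spray k j y * dirderiv m (dirderiv j (spray k m)) y)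
          = (?n + 1) * P\<^sup>2 - P * yB y - (?n + 1) * ax y + aB y"
      by (simp add: xy power2_eq_square)
    have S4: "(\<Sum>m\<in>UNIV. \<Sum>j\<in>UNIV. dirderiv j (spray k m) y * dirderiv m (spray k j) y) = (?n +
          3) * P\<^sup>2 - 4 * ax y - 2 * P * dA y + tt y"
      unfolding dirderiv_spray[OF y] P_def[symmetric] ax_def dA_def tt_def
      by (rule spray_square_trace[OF xy]) (use homog_euler[OF homog_spray_rest y] in auto)
    have ric: "ric k H y = 2 * (\<Sum>m\<in>UNIV. spray (H m) m y) - (\<Sum>m\<in>UNIV. \<Sum>j\<in>UNIV.
          dirderiv m (spray (H j) m) y * y $ j)
      + 2 * (\<Sum>m\<in>UNIV. \<Sum>j\<in>UNIV. spray k j y * dirderiv m (dirderiv j (spray k m)) y)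
      - (\<Sum>m\<in>UNIV. \<Sum>j\<in>UNIV. dirderiv j (spray k m) y * dirderiv m (spray k j) y)"
      by (simp add: ric_def sum.distrib sum_subtractf sum_distrib_left)
    \<comment> \<open>The coefficients combine as \<open>2 (n + 1) - (n + 3) = n - 1\<close> for the
      square of \<open>P\<close> and as \<open>4 - 2 (n + 1) = - 2 (n - 1)\<close> for
      \<open>ax\<close>.\<close>
    have "(f y)\<^sup>2 * ric k H y = 2 * ((f y)\<^sup>2 * (\<Sum>m\<in>UNIV. spray (H m) m y)) - (f y)\<^sup>2
          * (\<Sum>m\<in>UNIV. \<Sum>j\<in>UNIV. dirderiv m (spray (H j) m) y * y $ j)
      + (f y)\<^sup>2 * ((?n - 1) * P\<^sup>2 - 2 * P * yB y - 2 * (?n - 1) * ax y + 2 * aB y + 2 * P * dA y - tt y)"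
      unfolding ric S3 S4 by (simp add: algebra_simps)
    also have "\<dots> = 2 * f y * s1 y - f y * s2 y + (?n - 1) * (f y * P)\<^sup>2 - 2 * f y * (f y * P) * yB
          y - 2 * (?n - 1) * ((f y)\<^sup>2 * ax y)
       + 2 * (f y)\<^sup>2 * aB y + 2 * f y * (f y * P) * dA y - (f y)\<^sup>2 * tt y"
      unfolding S1 S2 by (simp add: algebra_simps power2_eq_square)
    \<comment> \<open>Besides the square of \<open>P\<close> this is the only source of a double
      pole.\<close>
    also have "(f y)\<^sup>2 * ax y = (\<Sum>j\<in>UNIV. spray_rest k j y * ((f y)\<^sup>2 * dirderiv j
          (proj_factor k) y))"
      by (simp add: ax_def sum_distrib_left mult_ac)
    also have "\<dots> = f y * ap y - proj_num k y * (\<Sum>j\<in>UNIV. spray_rest k j y * grad y $ j)"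
      unfolding dirderiv_proj_factor[OF y] ap_def by (simp add: algebra_simps sum_subtractf sum_distrib_left)
    finally have "(f y)\<^sup>2 * ric k H y = (?n - 1) * (proj_num k y * (proj_num k y + defect * alpha y * (k
          \<bullet> y)))
        + f y * (2 * s1 y - s2 y - 2 * proj_num k y * yB y - 2 * (?n - 1) * ap y + 2 * f y * aB y + 2 *
              proj_num k y * dA y - f y * tt y)"
      unfolding P spray_rest_grad[OF y] by (simp add: field_simps power2_eq_square)
    also have "proj_num k y * (proj_num k y + defect * alpha y * (k \<bullet> y)) = (3 * (defect * alpha y * (k
          \<bullet> y))\<^sup>2 + f y * ((k \<bullet> y)\<^sup>2 * (f y + 4 * defect * alpha y))) / 4"
      by (simp add: proj_num_def field_simps power2_eq_square)
    finally show ?thesis unfolding q_def ric_lead_def by (simp add: field_simps)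
  qed
  then show ?thesis using q by blast
qed

lemma homog_ric_lead: "homog s 4 (ric_lead k)"
proof -
  have "homog s 4 (\<lambda>y. (alpha y * (k \<bullet> y)) * (alpha y * (k \<bullet> y)))"
    by (intro homog_mult'[OF homog_mult[OF homog_alpha homog_lin] homog_mult[OF homog_alpha homog_lin]]) simp
  then have "homog s 4 (\<lambda>y. (3 / 4 * (real CARD('n) - 1) * defect\<^sup>2) * ((alpha y * (k \<bullet>
        y)) * (alpha y * (k \<bullet> y))))"
    by (rule homog_scale)
  then show ?thesis by (rule homog_cong) (simp add: ric_lead_def power2_eq_square)
qed

text \<open>Each factor \<open>y\<close> in \<open>ginv\<close> is contracted by Euler's identity
  and so lowers the order of differentiation of \<open>R\<close>. The three kinds of summands of
  \<open>ginv\<close> then all give order 5, with leading contributions -6, -4 and -2 times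
  \<open>defect * alpha * N\<close>, from \<open>a_inv\<close>, the mixed terms and the
  \<open>y y\<close> term; they add up instead of cancelling.\<close>

lemma ginv_contract_pole:
  assumes R: "homog True 2 R" and N: "homog False 4 N" and NR: "\<And>y. y \<noteq> 0 \<Longrightarrow> (f
        y)\<^sup>2 * R y = N y"
  shows "\<exists>q. homog False 4 q \<and> (\<forall>y. y \<noteq> 0 \<longrightarrow>
    (f y) ^ 5 * (\<Sum>i\<in>UNIV. \<Sum>j\<in>UNIV. ginv y $ i $ j * dirderiv j (dirderiv i R) y) = - 12 *
          defect * alpha y * N y + f y * q y)"
proof -
  define F where "F i = dirderiv i f" for i
  have F: "homog s 0 (F i)" for s i using homog_dirderiv[OF homog_f, of s i] by (simp add: F_def)
  have Fdf: "F i y = grad y $ i" if "y \<noteq> 0" for i y using that by (simp add: F_def dirderiv_f)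
  note homog_N1 = homog_dirderiv[OF N]
  note homog_R1 = homog_dirderiv[OF R]
  have R1: "f y * (f y * f y) * dirderiv i R y = f y * dirderiv i N y - 2 * (N y * F i y)" if y: "y \<noteq> 0"
        for i y
  proof -
    have "dirderiv i N y = dirderiv i (\<lambda>y. (f y * f y) * R y) y"
      by (rule dirderiv_cong_nonzero[OF y]) (simp add: NR[symmetric] power2_eq_square)
    also have "\<dots> = (F i y * f y + f y * F i y) * R y + (f y * f y) * dirderiv i R y"
      by (simp add: dirderiv_mult_homog[OF homog_mult[OF homog_f homog_f] R y] dirderiv_mult_homog[OF homog_f
            homog_f y] F_def)
    finally show ?thesis using NR[OF y] by (simp add: algebra_simps power2_eq_square)
  qed
  \<comment> \<open>What remains of \<open>f^4\<close> times the Hessian after its value at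
    \<open>f = 0\<close> is split off; the factor 6 of the latter is \<open>(-2) (-3)\<close> from
    differentiating \<open>N / f^2\<close> twice.\<close>
  define M where "M i j y = f y * dirderiv j (dirderiv i N) y - 2 * (F j y * dirderiv i N y) - 2 * (F i y *
        dirderiv j N y)
     - 2 * (N y * dirderiv j (F i) y)" for i j y
  have homog_M: "homog False 3 (M i j)" for i j unfolding M_def[abs_def]
    by (intro homog_diff homog_scale homog_mult'[OF homog_f homog_dirderiv[OF homog_N1]] homog_mult'[OF F
          homog_N1] homog_mult'[OF N homog_dirderiv[OF F]]) auto
  have R2: "(f y) ^ 4 * dirderiv j (dirderiv i R) y = 6 * N y * F i y * F j y + f y * M i j y" if y: "y
        \<noteq> 0" for i j y
  proof -
    have "dirderiv j (\<lambda>y. f y * (f y * f y) * dirderiv i R y) y = dirderiv j (\<lambda>y. f y *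
          dirderiv i N y - 2 * (N y * F i y)) y"
      by (rule dirderiv_cong_nonzero[OF y R1])
    also have "dirderiv j (\<lambda>y. f y * dirderiv i N y - 2 * (N y * F i y)) y
       = dirderiv j (\<lambda>y. f y * dirderiv i N y) y - dirderiv j (\<lambda>y. 2 * (N y * F i y)) y"
      by (rule dirderiv_diff_homog[OF homog_mult[OF homog_f homog_N1] homog_scale[OF homog_mult[OF N F]] y])
    also have "\<dots> = (F j y * dirderiv i N y + f y * dirderiv j (dirderiv i N) y) - 2 * (dirderiv j N y * F
          i y + N y * dirderiv j (F i) y)"
      by (simp only: dirderiv_scale_homog[OF homog_mult[OF N F] y] dirderiv_mult_homog[OF homog_f homog_N1 y]
            dirderiv_mult_homog[OF N F y]) (simp only: F_def)
    also have "dirderiv j (\<lambda>y. f y * (f y * f y) * dirderiv i R y) y =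
      (F j y * (f y * f y) + f y * (F j y * f y + f y * F j y)) * dirderiv i R y + f y * (f y * f y) * dirderiv
            j (dirderiv i R) y"
      by (simp only: dirderiv_mult_homog[OF homog_mult[OF homog_f homog_mult[OF homog_f homog_f]] homog_R1 y]
            dirderiv_mult_homog[OF homog_f homog_mult[OF homog_f homog_f] y]
         dirderiv_mult_homog[OF homog_f homog_f y]) (simp only: F_def)
    finally have *: "f y * (f y * f y) * dirderiv j (dirderiv i R) y = F j y * dirderiv i N y + f y * dirderiv
          j (dirderiv i N) y
       - 2 * (dirderiv j N y * F i y + N y * dirderiv j (F i) y) - 3 * F j y * (f y * f y) * dirderiv i R y"
      by (simp add: algebra_simps)
    have "(f y) ^ 4 * dirderiv j (dirderiv i R) y = f y * (f y * (f y * f y) * dirderiv j (dirderiv i R) y)"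
      by (simp add: power4_eq_xxxx)
    also have "\<dots> = f y * (F j y * dirderiv i N y + f y * dirderiv j (dirderiv i N) y
       - 2 * (dirderiv j N y * F i y + N y * dirderiv j (F i) y)) - 3 * F j y * (f y * (f y * f y) * dirderiv i R y)"
      unfolding * by (simp add: algebra_simps)
    finally show ?thesis unfolding R1[OF y] M_def by (simp add: algebra_simps)
  qed
  \<comment> \<open>18 = 12 + 4 + 2 collects the parts divisible by \<open>f\<close> of the same
    three contributions.\<close>
  define q where "q y = 18 * N y + alpha y * (\<Sum>i\<in>UNIV. \<Sum>j\<in>UNIV. a_inv $ i $ j * M i j y) - 2
        * (alpha y * (\<Sum>i\<in>UNIV. b_sharp $ i * dirderiv i N y))" for y
  have "homog False 4 q" unfolding q_def[abs_def]
    by (intro homog_add homog_diff homog_scale N homog_mult'[OF homog_alpha homog_sum[OF finite homog_sum[OF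
          finite homog_scale[OF homog_M]]]]
       homog_mult'[OF homog_alpha homog_sum[OF finite homog_scale[OF homog_N1]]]) auto
  moreover have "(f y) ^ 5 * (\<Sum>i\<in>UNIV. \<Sum>j\<in>UNIV. ginv y $ i $ j * dirderiv j (dirderiv i R) y)
        = - 12 * defect * alpha y * N y + f y * q y" if y: "y \<noteq> 0" for y
  proof -
    have f: "f y \<noteq> 0" using f_pos[OF y] by auto
    define r where "r i j = dirderiv j (dirderiv i R) y" for i j
    define C where "C = f y - defect * alpha y"
    have g: "(f y) ^ 5 * (ginv y $ i $ j * z) = alpha y * (a_inv $ i $ j * ((f y) ^ 4 * z)) - alpha y * (f y) ^
          3 * (b_sharp $ i * (y $ j * z))
        - alpha y * (f y) ^ 3 * (b_sharp $ j * (y $ i * z)) + C * (f y)\<^sup>2 * (y $ i * (y $ j * z))" for i j z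
      using f by (simp add: ginv_def C_def[symmetric]) (simp add: field_simps eval_nat_numeral)
    have e1: "(\<Sum>j\<in>UNIV. y $ j * r i j) = dirderiv i R y" for i
      using homog_euler[OF homog_R1 y, of i] by (simp add: r_def)
    have e2: "(\<Sum>i\<in>UNIV. y $ i * r i j) = dirderiv j R y" for j
      using dirderiv_second_euler[OF R y, of j] by (simp add: r_def)
    have e3: "(\<Sum>i\<in>UNIV. y $ i * dirderiv i R y) = 2 * R y" using homog_euler[OF R y] by simp
    have "(f y) ^ 5 * (\<Sum>i\<in>UNIV. \<Sum>j\<in>UNIV. ginv y $ i $ j * r i j)
      = alpha y * (\<Sum>i\<in>UNIV. \<Sum>j\<in>UNIV. a_inv $ i $ j * ((f y) ^ 4 * r i j)) - alpha y * (f y) ^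
            3 * (\<Sum>i\<in>UNIV. \<Sum>j\<in>UNIV. b_sharp $ i * (y $ j * r i j))
       - alpha y * (f y) ^ 3 * (\<Sum>i\<in>UNIV. \<Sum>j\<in>UNIV. b_sharp $ j * (y $ i * r i j)) + C * (f
             y)\<^sup>2 * (\<Sum>i\<in>UNIV. \<Sum>j\<in>UNIV. y $ i * (y $ j * r i j))"
      unfolding sum_distrib_left g sum.distrib sum_subtractf ..
    also have "(\<Sum>i\<in>UNIV. \<Sum>j\<in>UNIV. b_sharp $ i * (y $ j * r i j)) = (\<Sum>i\<in>UNIV. b_sharp
          $ i * dirderiv i R y)"
      by (simp only: sum_distrib_left[symmetric] e1)
    also have "(\<Sum>i\<in>UNIV. \<Sum>j\<in>UNIV. b_sharp $ j * (y $ i * r i j)) = (\<Sum>i\<in>UNIV. b_sharp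
          $ i * dirderiv i R y)"
      by (subst sum.swap) (simp only: sum_distrib_left[symmetric] e2)
    also have "(\<Sum>i\<in>UNIV. \<Sum>j\<in>UNIV. y $ i * (y $ j * r i j)) = 2 * R y"
      by (simp only: sum_distrib_left[symmetric] e1 e3)
    also have "(\<Sum>i\<in>UNIV. \<Sum>j\<in>UNIV. a_inv $ i $ j * ((f y) ^ 4 * r i j)) = 6 * N y * ((a_inv *v
          grad y) \<bullet> grad y) + f y * (\<Sum>i\<in>UNIV. \<Sum>j\<in>UNIV. a_inv $ i $ j * M i j y)"
      unfolding r_def R2[OF y] Fdf[OF y]
      by (simp add: inner_vec_def matrix_vector_mult_def sum_distrib_left sum_distrib_right distrib_left
            sum.distrib mult_ac)
    finally have "(f y) ^ 5 * (\<Sum>i\<in>UNIV. \<Sum>j\<in>UNIV. ginv y $ i $ j * r i j)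
      = 6 * N y * (alpha y * ((a_inv *v grad y) \<bullet> grad y)) + f y * (alpha y * (\<Sum>i\<in>UNIV.
            \<Sum>j\<in>UNIV. a_inv $ i $ j * M i j y))
       - 2 * alpha y * (\<Sum>i\<in>UNIV. b_sharp $ i * (f y * (f y * f y) * dirderiv i R y)) + 2 * C * ((f
             y)\<^sup>2 * R y)"
      by (simp add: algebra_simps power3_eq_cube sum_distrib_left)
    also have "(\<Sum>i\<in>UNIV. b_sharp $ i * (f y * (f y * f y) * dirderiv i R y)) = f y *
          (\<Sum>i\<in>UNIV. b_sharp $ i * dirderiv i N y) - 2 * N y * (b_sharp \<bullet> grad y)"
      unfolding R1[OF y] Fdf[OF y] by (simp add: inner_vec_def sum_distrib_left sum_subtractf algebra_simps)
    finally have "(f y) ^ 5 * (\<Sum>i\<in>UNIV. \<Sum>j\<in>UNIV. ginv y $ i $ j * r i j)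
      = 6 * N y * (alpha y * ((a_inv *v grad y) \<bullet> grad y)) + f y * (alpha y * (\<Sum>i\<in>UNIV.
            \<Sum>j\<in>UNIV. a_inv $ i $ j * M i j y))
       - f y * (2 * (alpha y * (\<Sum>i\<in>UNIV. b_sharp $ i * dirderiv i N y))) + 4 * N y * (alpha y *
             (b_sharp \<bullet> grad y)) + 2 * C * N y"
      unfolding NR[OF y] by (simp add: algebra_simps)
    then show ?thesis unfolding a_inv_grad_grad[OF y] b_sharp_grad[OF y] r_def[symmetric] q_def C_def by (simp
          add: algebra_simps)
  qed
  ultimately show ?thesis by blast
qed

lemma scalar_pole:
  "\<exists>q. homog False 4 q \<and> (\<forall>y. y \<noteq> 0 \<longrightarrow>
    (f y) ^ 5 * (\<Sum>i\<in>UNIV. \<Sum>j\<in>UNIV. ginv y $ i $ j * dirderiv j (dirderiv i (ric k H)) y) = -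
          12 * defect * alpha y * ric_lead k y + f y * q y)"
proof -
  obtain q where q: "homog False 3 q" "\<And>y. y \<noteq> 0 \<Longrightarrow> (f y)\<^sup>2 * ric k H y =
        ric_lead k y + f y * q y"
    using ric_pole by blast
  have "homog False 4 (\<lambda>y. ric_lead k y + f y * q y)"
    by (intro homog_add homog_ric_lead homog_mult'[OF homog_f q(1)]) simp
  from ginv_contract_pole[OF homog_ric this q(2)] obtain q' where q': "homog False 4 q'" "\<And>y. y \<noteq> 0
        \<Longrightarrow>
    (f y) ^ 5 * (\<Sum>i\<in>UNIV. \<Sum>j\<in>UNIV. ginv y $ i $ j * dirderiv j (dirderiv i (ric k H)) y) = -
          12 * defect * alpha y * (ric_lead k y + f y * q y) + f y * q' y"
    by blast
  have "homog False 4 (\<lambda>y. q' y - 12 * defect * (alpha y * q y))"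
    by (intro homog_diff homog_scale q' homog_mult'[OF homog_alpha q(1)]) simp
  then show ?thesis using q'(2) by (intro exI[of _ "\<lambda>y. q' y - 12 * defect * (alpha y * q y)"]) (simp
        add: algebra_simps)
qed

section \<open>Evaluation at complex zeros of the norm\<close>

text \<open>On the unit circle of an \<open>a\<close>-orthonormal pair, \<open>alpha\<close> and
  \<open>1 / alpha\<close> are constantly 1 and linear forms are trigonometric, so sums and products
  stay entire. Only \<open>1 / f\<close> could create poles, and the flag \<open>False\<close>
  excludes it.\<close>

lemma homog_entire_extension:
  assumes e: "e \<bullet> (a *v e) = 1" and u: "u \<bullet> (a *v u) = 1" and eu: "e \<bullet> (a *v u) = 0"
    and "homog False d g"
  shows "\<exists>G. G holomorphic_on UNIV \<and>
    (\<forall>t::real. G (of_real t) = complex_of_real (g (cos t *\<^sub>R e + sin t *\<^sub>R u)))"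
proof -
  have ue: "u \<bullet> (a *v e) = 0" using eu a_inner[of e u] by (simp add: inner_commute)
  have alpha: "alpha (cos t *\<^sub>R e + sin t *\<^sub>R u) = 1" for t
  proof -
    have "(cos t *\<^sub>R e + sin t *\<^sub>R u) \<bullet> (a *v (cos t *\<^sub>R e + sin t *\<^sub>R u)) =
          (cos t)\<^sup>2 + (sin t)\<^sup>2"
      by (simp add: matrix_vector_right_distrib matrix_vector_mult_scaleR inner_add_left inner_add_right e u eu
            ue power2_eq_square)
    then show ?thesis by (simp add: alpha_def)
  qed
  have nz: "cos t *\<^sub>R e + sin t *\<^sub>R u \<noteq> 0" for t using alpha[of t] by (auto simp: alpha_def)
  from assms(4) show ?thesis
  proof (induction rule: homog.induct)
    case (homog_const r)
    show ?case by (rule exI[of _ "\<lambda>_. of_real r"]) auto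
  next
    case (homog_zero d)
    show ?case by (rule exI[of _ "\<lambda>_. 0"]) auto
  next
    case (homog_lin l)
    show ?case
      by (rule exI[of _ "\<lambda>z. cos z * of_real (l \<bullet> e) + sin z * of_real (l \<bullet> u)"])
         (auto intro!: holomorphic_intros simp: inner_add_right simp flip: cos_of_real sin_of_real)
  next
    case homog_alpha
    show ?case by (rule exI[of _ "\<lambda>_. 1"]) (auto simp: alpha)
  next
    case homog_inv_alpha
    show ?case by (rule exI[of _ "\<lambda>_. 1"]) (auto simp: alpha)
  next
    case (homog_add d g h)
    then obtain G H where "G holomorphic_on UNIV" "H holomorphic_on UNIV"
      "\<And>t::real. G (of_real t) = complex_of_real (g (cos t *\<^sub>R e + sin t *\<^sub>R u))"
      "\<And>t::real. H (of_real t) = complex_of_real (h (cos t *\<^sub>R e + sin t *\<^sub>R u))" by blast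
    then show ?case by (intro exI[of _ "\<lambda>z. G z + H z"]) (auto intro!: holomorphic_intros)
  next
    case (homog_mult d g e' h)
    then obtain G H where "G holomorphic_on UNIV" "H holomorphic_on UNIV"
      "\<And>t::real. G (of_real t) = complex_of_real (g (cos t *\<^sub>R e + sin t *\<^sub>R u))"
      "\<And>t::real. H (of_real t) = complex_of_real (h (cos t *\<^sub>R e + sin t *\<^sub>R u))" by blast
    then show ?case by (intro exI[of _ "\<lambda>z. G z * H z"]) (auto intro!: holomorphic_intros)
  next
    case (homog_cong d g h)
    then show ?case using nz by auto
  qed auto
qed

text \<open>Positivity of \<open>f\<close> in the single direction \<open>- b_sharp\<close>, where
  its value is \<open>|b| - |b|^2\<close>, already gives \<open>|b| < 1\<close>.\<close>

lemma b_sharp_bounds: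
  assumes "b \<noteq> 0"
  shows "0 < b \<bullet> b_sharp" "b \<bullet> b_sharp < 1"
proof -
  have abs: "a *v b_sharp = b" by (simp add: b_sharp_def)
  then have b_sharp: "b_sharp \<noteq> 0" using assms by auto
  from pos[OF b_sharp] show p: "0 < b \<bullet> b_sharp" by (simp add: abs inner_commute)
  have "a *v (- b_sharp) = - b" using matrix_vector_mult_scaleR[of a "- 1" b_sharp] abs by simp
  then have "0 < sqrt (b \<bullet> b_sharp) + - (b \<bullet> b_sharp)" using f_pos'[of "- b_sharp"] b_sharp by
        (simp add: inner_commute)
  then have "sqrt (b \<bullet> b_sharp) * sqrt (b \<bullet> b_sharp) < 1 * sqrt (b \<bullet> b_sharp)" using p by simp
  then have "sqrt (b \<bullet> b_sharp) < 1" using p by (metis mult_less_cancel_right_pos real_sqrt_gt_zero)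
  then show "b \<bullet> b_sharp < 1" by simp
qed

text \<open>At a complex zero of \<open>f\<close> the right side drops out and the complexified
  \<open>k\<close> vanishes on one complex vector. Since \<open>k\<close> is real, and the
  coordinates of that vector are real and purely imaginary respectively, this single complex
  equation yields two real ones.\<close>

lemma vanish_on_circle:
  assumes b: "b \<noteq> 0" and u: "u \<noteq> 0" "b \<bullet> u = 0" and C: "C \<noteq> 0" and q: "homog False d q"
    and eq: "\<And>y. y \<noteq> 0 \<Longrightarrow> C * (alpha y) ^ 3 * (k \<bullet> y)\<^sup>2 = f y * q y"
  shows "k \<bullet> u = 0 \<and> k \<bullet> b_sharp = 0"
proof -
  define B where "B = sqrt (b \<bullet> b_sharp)"
  have B: "0 < B" "B < 1" "B\<^sup>2 = b \<bullet> b_sharp" using b_sharp_bounds[OF b] by (auto simp: B_def)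
  define e where "e = (1 / B) *\<^sub>R b_sharp"
  define v where "v = (1 / alpha u) *\<^sub>R u"
  have abs: "a *v b_sharp = b" by (simp add: b_sharp_def)
  have alu: "alpha u > 0" using alpha_pos u by blast
  have ae: "a *v e = (1 / B) *\<^sub>R b" by (simp add: e_def matrix_vector_mult_scaleR abs)
  have e: "e \<bullet> (a *v e) = 1" using B unfolding ae unfolding e_def
    by (simp add: inner_commute power2_eq_square[symmetric] B(3)[symmetric])
  have v: "v \<bullet> (a *v v) = 1" using alu by (simp add: v_def matrix_vector_mult_scaleR alpha_sq[symmetric])
  have ev: "e \<bullet> (a *v v) = 0" using u by (simp add: a_inner ae v_def)
  have be: "b \<bullet> e = B" using B by (simp add: e_def power2_eq_square[symmetric] B(3)[symmetric]) (simp
        add: power2_eq_square)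
  have bv: "b \<bullet> v = 0" using u by (simp add: v_def)
  define Y where "Y t = cos t *\<^sub>R e + sin t *\<^sub>R v" for t
  have alY: "alpha (Y t) = 1" for t
  proof -
    have ve: "v \<bullet> (a *v e) = 0" using ev a_inner[of e v] by (simp add: inner_commute)
    have "Y t \<bullet> (a *v Y t) = (cos t)\<^sup>2 + (sin t)\<^sup>2"
      by (simp add: Y_def matrix_vector_right_distrib matrix_vector_mult_scaleR inner_add_left inner_add_right
            e v ev ve power2_eq_square)
    then show ?thesis by (simp add: alpha_def)
  qed
  obtain G where G: "G holomorphic_on UNIV" "\<And>t::real. G (of_real t) = complex_of_real (q (Y t))"
    using homog_entire_extension[OF e v ev q] unfolding Y_def by blast
  \<comment> \<open>The difference of both sides of \<open>eq\<close> along the circle, where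
    \<open>alpha\<close> is 1 and \<open>f (Y t) = 1 + B * cos t\<close>.\<close>
  define W where "W z = of_real C * (cos z * of_real (k \<bullet> e) + sin z * of_real (k \<bullet> v))\<^sup>2
        - (1 + of_real B * cos z) * G z" for z :: complex
  have W: "W holomorphic_on UNIV" unfolding W_def[abs_def] by (intro holomorphic_intros G)
  have W0: "W z = 0" if zU: "z \<in> range complex_of_real" for z
  proof -
    from zU obtain t where z: "z = of_real t" by auto
    have "C * (alpha (Y t)) ^ 3 * (k \<bullet> Y t)\<^sup>2 = f (Y t) * q (Y t)"
      by (rule eq) (use alY[of t] in \<open>auto simp: alpha_def\<close>)
    then have "C * (cos t * (k \<bullet> e) + sin t * (k \<bullet> v))\<^sup>2 - (1 + B * cos t) * q (Y t) = 0"
      by (simp add: alY f_def) (simp add: Y_def inner_add_right be bv mult.commute)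
    moreover have "W z = of_real (C * (cos t * (k \<bullet> e) + sin t * (k \<bullet> v))\<^sup>2 - (1 + B *
          cos t) * q (Y t))"
      by (simp add: W_def z G(2) cos_of_real sin_of_real)
    ultimately show ?thesis by (simp only: of_real_0)
  qed
  have lim: "(0::complex) islimpt range complex_of_real"
    unfolding islimpt_approachable
  proof (intro allI impI)
    fix r :: real assume "0 < r"
    then show "\<exists>x'\<in>range complex_of_real. x' \<noteq> 0 \<and> dist x' 0 < r"
      by (intro bexI[OF _ rangeI[of complex_of_real "r / 2"]]) simp
  qed
  \<comment> \<open>A zero of \<open>1 + B * cos z\<close>. It cannot be real because
    \<open>1 / B > 1\<close>.\<close>
  define z where "z = Arccos (- (1 / of_real B))"
  have cz: "cos z = - (1 / of_real B)" by (simp add: z_def)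
  have "W z = 0"
    by (rule analytic_continuation[OF W open_UNIV connected_UNIV subset_UNIV UNIV_I lim]) (use W0 in auto)
  then have "cos z * of_real (k \<bullet> e) + sin z * of_real (k \<bullet> v) = 0"
    using C B by (simp add: W_def cz)
  \<comment> \<open>Squaring replaces \<open>sin z\<close> by the real number
    \<open>1 - 1 / B\<^sup>2\<close>, with no choice of a root. As this number is negative, a
    nonpositive quantity equals a nonnegative one, and both vanish.\<close>
  then have "(sin z * of_real (k \<bullet> v))\<^sup>2 = (cos z * of_real (k \<bullet> e))\<^sup>2"
    by (metis add_eq_0_iff power2_minus)
  then have "(1 - (cos z)\<^sup>2) * (of_real (k \<bullet> v))\<^sup>2 = (cos z)\<^sup>2 * (of_real (k
        \<bullet> e))\<^sup>2"
    by (metis power_mult_distrib sin_squared_eq)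
  then have "complex_of_real ((1 - 1 / B\<^sup>2) * (k \<bullet> v)\<^sup>2) = of_real (1 / B\<^sup>2 * (k
        \<bullet> e)\<^sup>2)"
    by (simp add: cz power_divide)
  then have *: "(1 - 1 / B\<^sup>2) * (k \<bullet> v)\<^sup>2 = 1 / B\<^sup>2 * (k \<bullet> e)\<^sup>2" by
        (simp only: of_real_eq_iff)
  have "B\<^sup>2 < 1" using b_sharp_bounds[OF b] B by simp
  then have neg: "1 - 1 / B\<^sup>2 < 0" using B(1) by (simp add: field_simps)
  have "0 \<le> 1 / B\<^sup>2 * (k \<bullet> e)\<^sup>2" by simp
  with * neg have "(k \<bullet> v)\<^sup>2 \<le> 0" by (metis mult_neg_pos not_less)
  then have kv: "k \<bullet> v = 0" by simp
  with * B(1) have "k \<bullet> e = 0" by simp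
  with kv show ?thesis using alu B(1) by (simp add: v_def e_def)
qed

text \<open>Any single \<open>u\<close> in the kernel of \<open>b\<close> yields
  \<open>k \<bullet> b_sharp = 0\<close>; a nonzero one exists because the dimension is at least 2.
  A second choice, adapted to \<open>k\<close>, then finishes.\<close>

lemma covector_vanishes:
  assumes b: "b \<noteq> 0" and n: "CARD('n) \<ge> 2" and C: "C \<noteq> 0" and q: "homog False d q"
    and eq: "\<And>y. y \<noteq> 0 \<Longrightarrow> C * (alpha y) ^ 3 * (k \<bullet> y)\<^sup>2 = f y * q y"
  shows "k = 0"
proof -
  note van = vanish_on_circle[OF b _ _ C q eq]
  obtain u where "u \<noteq> 0" "orthogonal b u" using orthogonal_to_vector_exists[of b] n by auto
  then have kbs: "k \<bullet> b_sharp = 0" using van[of u] by (simp add: orthogonal_def)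
  \<comment> \<open>The projection of \<open>k\<close> to the kernel of \<open>b\<close> along
    \<open>b_sharp\<close>. Since \<open>k \<bullet> b_sharp = 0\<close>,
    \<open>k \<bullet> w\<close> is \<open>k \<bullet> k\<close>.\<close>
  define w where "w = k - ((b \<bullet> k) / (b \<bullet> b_sharp)) *\<^sub>R b_sharp"
  have "b \<bullet> w = 0" using b_sharp_bounds[OF b] by (simp add: w_def inner_diff_right)
  then have "k \<bullet> w = 0" using van[of w] by (cases "w = 0") auto
  then show "k = 0" by (simp add: w_def inner_diff_right kbs)
qed

lemma defect_pos: "b \<noteq> 0 \<Longrightarrow> 0 < defect" using b_sharp_bounds by (simp add: defect_def)

lemma covector_vanishes_of_scalar:
  assumes b: "b \<noteq> 0" and n: "CARD('n) \<ge> 2"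
    and eq: "\<And>y. y \<noteq> 0 \<Longrightarrow> (\<Sum>i\<in>UNIV. \<Sum>j\<in>UNIV. ginv y $ i $ j *
          dirderiv j (dirderiv i (ric k H)) y) = (th \<bullet> y) / f y + mu"
  shows "k = 0"
proof -
  obtain q where q: "homog False 4 q" "\<And>y. y \<noteq> 0 \<Longrightarrow>
    (f y) ^ 5 * (\<Sum>i\<in>UNIV. \<Sum>j\<in>UNIV. ginv y $ i $ j * dirderiv j (dirderiv i (ric k H)) y) = -
          12 * defect * alpha y * ric_lead k y + f y * q y"
    using scalar_pole by blast
  \<comment> \<open>\<open>f^5 * (\<theta> / f + \<mu>)\<close> is divisible by \<open>f^4\<close>;
    one factor \<open>f\<close> is left outside.\<close>
  define q' where "q' y = ((f y)\<^sup>2 * (f y)\<^sup>2) * mu + (f y * (f y)\<^sup>2) * (th \<bullet> y) - q y" for y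
  have "homog False 4 q'" unfolding q'_def[abs_def]
    by (intro homog_add homog_diff homog_scale_right q homog_mult'[OF homog_sq[OF homog_f] homog_sq[OF homog_f]]
        homog_mult'[OF homog_mult[OF homog_f homog_sq[OF homog_f]] homog_lin]) auto
  \<comment> \<open>-9 is -12 times the 3/4 of \<open>ric_lead\<close>, and
    \<open>defect ^ 3\<close> is the square in \<open>ric_lead\<close> times the factor of the
    contraction.\<close>
  moreover have "(- 9 * (real CARD('n) - 1) * defect ^ 3) * (alpha y) ^ 3 * (k \<bullet> y)\<^sup>2 = f y * q'
        y" if y: "y \<noteq> 0" for y
  proof -
    have "- 12 * defect * alpha y * ric_lead k y + f y * q y = (f y) ^ 5 * ((th \<bullet> y) / f y + mu)"
      using q(2)[OF y] eq[OF y] by simp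
    also have "\<dots> = f y * (((f y)\<^sup>2 * (f y)\<^sup>2) * mu + (f y * (f y)\<^sup>2) * (th \<bullet> y))"
      using f_pos[OF y] by (simp add: field_simps eval_nat_numeral)
    finally have "- 12 * defect * alpha y * ric_lead k y = f y * q' y" by (simp add: q'_def algebra_simps)
    then show ?thesis by (simp add: ric_lead_def power_mult_distrib algebra_simps power2_eq_square power3_eq_cube)
  qed
  moreover have "- 9 * (real CARD('n) - 1) * defect ^ 3 \<noteq> 0" using defect_pos[OF b] n by auto
  ultimately show ?thesis using covector_vanishes[OF b n] by blast
qed

end

section \<open>Conformal changes of a Randers norm\<close>

lemma pdx_eq: "pdx i F x y = dirderiv i (\<lambda>x. F x y) x"
  by (simp add: pdx_def dirderiv_def)

lemma pdy_fun_eq: "pdy i F x = dirderiv i (F x)"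
  by (rule ext) (rule pdy_eq)

lemma scaleR_matrix_mult:
  fixes A B :: "real ^ 'n ^ 'n::finite"
  shows "(c *\<^sub>R A) ** (d *\<^sub>R B) = (c * d) *\<^sub>R (A ** B)"
  by (simp add: matrix_matrix_mult_def vec_eq_iff sum_distrib_left mult_ac)

text \<open>The first and second partial derivatives of \<open>\<kappa>\<close> enter as the data
  \<open>k\<close> and \<open>H\<close>, so that the curvature at a point becomes an expression in
  \<open>y\<close> alone.\<close>

locale conformal_randers = randers_norm a b for a :: "real ^ 'n ^ 'n::finite" and b :: "real ^ 'n" +
  fixes X :: "(real ^ 'n) set" and \<kappa> :: "real ^ 'n \<Rightarrow> real" and k :: "real ^ 'n \<Rightarrow>
        real ^ 'n"
    and H :: "real ^ 'n \<Rightarrow> 'n \<Rightarrow> real ^ 'n" and F :: "real ^ 'n \<Rightarrow> real ^ 'n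
          \<Rightarrow> real"
  assumes open_X: "open X"
    and has_dirderiv_\<kappa>: "x \<in> X \<Longrightarrow> has_dirderiv i \<kappa> x (k x $ i)"
    and has_dirderiv_k: "x \<in> X \<Longrightarrow> has_dirderiv j (\<lambda>x. k x $ l) x (H x j $ l)"
    and F_eq: "x \<in> X \<Longrightarrow> F x y = exp (\<kappa> x) * f y"
begin

lemma sq_F: "x \<in> X \<Longrightarrow> sq F x y = exp (2 * \<kappa> x) * (f y)\<^sup>2"
  by (simp add: sq_def F_eq power_mult_distrib exp_double)

lemma pdx_sq_F:
  assumes "x \<in> X"
  shows "pdx m (sq F) x y = 2 * k x $ m * exp (2 * \<kappa> x) * (f y)\<^sup>2"
proof -
  have "has_dirderiv m (\<lambda>x. exp (2 * \<kappa> x) * (f y)\<^sup>2) x (2 * k x $ m * exp (2 * \<kappa> x)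
        * (f y)\<^sup>2)"
    using has_dirderiv_\<kappa>[OF assms, of m] unfolding has_dirderiv_def
    by (auto intro!: derivative_eq_intros)
  then have "has_dirderiv m (\<lambda>x. sq F x y) x (2 * k x $ m * exp (2 * \<kappa> x) * (f y)\<^sup>2)"
    by (subst has_dirderiv_cong[OF open_X assms]) (auto simp: sq_F)
  then show ?thesis by (simp add: pdx_eq dirderivI)
qed

lemma dirderiv_f_sq: "y \<noteq> 0 \<Longrightarrow> dirderiv l (\<lambda>y. r * (f y)\<^sup>2) y = r * (2 * f
      y * grad y $ l)"
  using dirderiv_scale_homog[OF homog_sq[OF homog_f]] dirderiv_mult_homog[OF homog_f homog_f]
  by (simp add: power2_eq_square dirderiv_f)

lemma pdy_pdx_sq_F:
  assumes "x \<in> X" "y \<noteq> 0"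
  shows "pdy l (pdx m (sq F)) x y = 2 * k x $ m * exp (2 * \<kappa> x) * (2 * f y * grad y $ l)"
proof -
  have "pdx m (sq F) x = (\<lambda>y. (2 * k x $ m * exp (2 * \<kappa> x)) * (f y)\<^sup>2)"
    using pdx_sq_F[OF assms(1)] by auto
  then show ?thesis using dirderiv_f_sq[OF assms(2)] by (simp add: pdy_eq)
qed

lemma fund_tensor_F:
  assumes "x \<in> X" "y \<noteq> 0"
  shows "fund_tensor F x y = exp (2 * \<kappa> x) *\<^sub>R gmat y"
proof -
  have sq: "sq F x = (\<lambda>y. exp (2 * \<kappa> x) * (f y)\<^sup>2)" using sq_F[OF assms(1)] by auto
  have "pdy j (pdy i (sq F)) x y = exp (2 * \<kappa> x) * (2 * gmat y $ i $ j)" for i j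
  proof -
    have "pdy j (pdy i (sq F)) x y = dirderiv j (\<lambda>y. dirderiv i (\<lambda>y. exp (2 * \<kappa> x) * (f
          y)\<^sup>2) y) y"
      by (simp add: pdy_fun_eq sq)
    also have "\<dots> = dirderiv j (\<lambda>y. exp (2 * \<kappa> x) * dirderiv i (\<lambda>y. (f y)\<^sup>2) y) y"
      by (rule dirderiv_cong_nonzero[OF assms(2)]) (rule dirderiv_scale_homog[OF homog_sq[OF homog_f]])
    also have "\<dots> = exp (2 * \<kappa> x) * (2 * gmat y $ i $ j)"
      by (simp only: dirderiv_scale_homog[OF homog_dirderiv[OF homog_sq[OF homog_f]] assms(2)]
            dirderiv2_f_sq[OF assms(2)])
    finally show ?thesis .
  qed
  then show ?thesis by (simp add: fund_tensor_def vec_eq_iff)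
qed

lemma fund_tensor_inv_F:
  assumes "x \<in> X" "y \<noteq> 0"
  shows "fund_tensor_inv F x y = exp (- 2 * \<kappa> x) *\<^sub>R ginv y"
  unfolding fund_tensor_inv_def fund_tensor_F[OF assms]
  by (rule matrix_inv_eqI)
     (simp add: scaleR_matrix_mult gmat_ginv[OF assms(2)] exp_add[symmetric])

text \<open>\<open>f\<close> does not depend on the position, so only derivatives of
  \<open>\<kappa>\<close> contribute, and the exponential factors of the inverse tensor and of
  \<open>F^2\<close> cancel.\<close>

lemma geodesic_coeff_F:
  assumes x: "x \<in> X" and y: "y \<noteq> 0"
  shows "geodesic_coeff F i x y = spray (k x) i y"
proof -
  have f: "f y \<noteq> 0" using f_pos[OF y] by auto
  have ee: "exp (- 2 * \<kappa> x) * exp (2 * \<kappa> x) = 1" by (simp add: exp_add[symmetric])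
  have "(\<Sum>m\<in>UNIV. pdy l (pdx m (sq F)) x y * y $ m) = exp (2 * \<kappa> x) * (4 * f y * grad y $ l *
        (k x \<bullet> y))" for l
    by (simp add: pdy_pdx_sq_F[OF x y] inner_vec_def sum_distrib_left mult_ac)
  then have "geodesic_coeff F i x y = 1 / 4 * (\<Sum>l\<in>UNIV. (exp (- 2 * \<kappa> x) * ginv y $ i $ l) *
     (exp (2 * \<kappa> x) * (4 * f y * grad y $ l * (k x \<bullet> y)) - 2 * k x $ l * exp (2 * \<kappa> x) *
           (f y)\<^sup>2))"
    by (simp add: geodesic_coeff_def fund_tensor_inv_F[OF x y] pdx_sq_F[OF x])
  also have "\<dots> = (\<Sum>l\<in>UNIV. (exp (- 2 * \<kappa> x) * exp (2 * \<kappa> x)) * (f y * (k x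
        \<bullet> y) * (ginv y $ i $ l * grad y $ l) - (f y)\<^sup>2 / 2 * (ginv y $ i $ l * k x $ l)))"
    unfolding sum_distrib_left by (intro sum.cong refl) (simp add: algebra_simps)
  also have "\<dots> = f y * (k x \<bullet> y) * (ginv y *v grad y) $ i - (f y)\<^sup>2 / 2 * (ginv y *v k x) $ i"
    by (simp only: ee mult_1 sum_subtractf sum_distrib_left[symmetric] matrix_vector_mult_def vec_lambda_beta)
  also have "\<dots> = spray (k x) i y"
    unfolding ginv_grad[OF y] unfolding ginv_mult spray_def proj_factor_def proj_num_def spray_rest_def using f
    by simp (simp add: field_simps eval_nat_numeral)
  finally show ?thesis .
qed

text \<open>Puts the whole dependence on the position into the coefficients \<open>k x $ l\<close>,
  so that differentiating the spray by position replaces \<open>k x\<close> by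
  \<open>H x j\<close>.\<close>

lemma spray_linear: "spray h i y = (\<Sum>l\<in>UNIV. h $ l * spray (axis l 1) i y)"
proof -
  have lin: "linear (\<lambda>h. spray h i y)"
    by (rule linearI)
       (simp_all add: spray_def proj_factor_def proj_num_def spray_rest_def inner_add_left inner_add_right
             matrix_vector_right_distrib
          matrix_vector_mult_scaleR algebra_simps add_divide_distrib diff_divide_distrib)
  have "spray h i y = spray (\<Sum>l\<in>UNIV. h $ l *\<^sub>R axis l 1) i y" by (simp add: basis_expansion
        scalar_mult_eq_scaleR[symmetric])
  also have "\<dots> = (\<Sum>l\<in>UNIV. h $ l * spray (axis l 1) i y)"
    using linear_sum[OF lin, of "\<lambda>l. h $ l *\<^sub>R axis l 1" UNIV] linear_cmul[OF lin] by simp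
  finally show ?thesis .
qed

lemma pdx_geodesic_coeff_F:
  assumes x: "x \<in> X" and y: "y \<noteq> 0"
  shows "pdx j (geodesic_coeff F i) x y = spray (H x j) i y"
proof -
  have "has_dirderiv j (\<lambda>x. \<Sum>l\<in>UNIV. k x $ l * spray (axis l 1) i y) x (\<Sum>l\<in>UNIV. H x
        j $ l * spray (axis l 1) i y + k x $ l * 0)"
    by (intro has_dirderiv_sum has_dirderiv_mult has_dirderiv_const has_dirderiv_k x)
  then have "has_dirderiv j (\<lambda>x. spray (k x) i y) x (spray (H x j) i y)"
    by (simp add: spray_linear[symmetric])
  then have "has_dirderiv j (\<lambda>x. geodesic_coeff F i x y) x (spray (H x j) i y)"
    by (subst has_dirderiv_cong[OF open_X x]) (auto simp: geodesic_coeff_F y)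
  then show ?thesis by (simp add: pdx_eq dirderivI)
qed

lemma ricci_curvature_F:
  assumes x: "x \<in> X" and y: "y \<noteq> 0"
  shows "ricci_curvature F x y = ric (k x) (H x) y"
proof -
  have 1: "pdy j (geodesic_coeff F i) x y = dirderiv j (spray (k x) i) y" if "y \<noteq> 0" for i j y
    unfolding pdy_eq by (rule dirderiv_cong_nonzero[OF that geodesic_coeff_F[OF x]])
  have 2: "pdy m (pdy j (geodesic_coeff F i)) x y = dirderiv m (dirderiv j (spray (k x) i)) y" for i j m
    unfolding pdy_eq[of m] by (rule dirderiv_cong_nonzero[OF y 1])
  have 3: "pdy m (pdx j (geodesic_coeff F i)) x y = dirderiv m (spray (H x j) i) y" for i j m
    unfolding pdy_eq[of m] by (rule dirderiv_cong_nonzero[OF y pdx_geodesic_coeff_F[OF x]])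
  show ?thesis
    unfolding ricci_curvature_def riemann_curvature_def Let_def ric_def
    by (simp only: 1[OF y] 2 3 geodesic_coeff_F[OF x y] pdx_geodesic_coeff_F[OF x y])
qed

lemma scalar_curvature_F:
  assumes x: "x \<in> X" and y: "y \<noteq> 0"
  shows "scalar_curvature F x y = exp (- 2 * \<kappa> x) / 2 *
    (\<Sum>i\<in>UNIV. \<Sum>j\<in>UNIV. ginv y $ i $ j * dirderiv j (dirderiv i (ric (k x) (H x))) y)"
proof -
  have 1: "pdy i (ricci_curvature F) x y = dirderiv i (ric (k x) (H x)) y" if "y \<noteq> 0" for i y
    unfolding pdy_eq by (rule dirderiv_cong_nonzero[OF that ricci_curvature_F[OF x]])
  have 2: "pdy j (pdy i (ricci_curvature F)) x y = dirderiv j (dirderiv i (ric (k x) (H x))) y" for i j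
    unfolding pdy_eq[of j] by (rule dirderiv_cong_nonzero[OF y 1])
  show ?thesis
    by (simp add: scalar_curvature_def ricci_tensor_def 2 fund_tensor_inv_F[OF x y] sum_distrib_left mult.assoc)
qed

lemma conformal_factor_critical:
  assumes x: "x \<in> X" and b: "b \<noteq> 0" and n: "CARD('n) \<ge> 2"
    and eq: "\<And>y. y \<noteq> 0 \<Longrightarrow> scalar_curvature F x y = r * ((th \<bullet> y) / F x y + mu)"
  shows "k x = 0"
proof (rule covector_vanishes_of_scalar[OF b n])
  fix y :: "real ^ 'n" assume y: "y \<noteq> 0"
  let ?S = "\<Sum>i\<in>UNIV. \<Sum>j\<in>UNIV. ginv y $ i $ j * dirderiv j (dirderiv i (ric (k x) (H x))) y"
  have "exp (\<kappa> x) * exp (\<kappa> x) * exp (- 2 * \<kappa> x) = 1" by (simp add: exp_add[symmetric])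
  then have "?S = 2 * (exp (\<kappa> x) * exp (\<kappa> x)) * (exp (- 2 * \<kappa> x) / 2 * ?S)" by simp
  also have "\<dots> = 2 * (exp (\<kappa> x) * exp (\<kappa> x)) * (r * ((th \<bullet> y) / (exp (\<kappa> x) *
        f y) + mu))"
    by (simp only: scalar_curvature_F[OF x y, symmetric] eq[OF y] F_eq[OF x])
  also have "\<dots> = ((2 * exp (\<kappa> x) * r) *\<^sub>R th) \<bullet> y / f y + 2 * (exp (\<kappa> x) *
        exp (\<kappa> x)) * r * mu"
    using f_pos[OF y] by (simp add: field_simps)
  finally show "?S = ((2 * exp (\<kappa> x) * r) *\<^sub>R th) \<bullet> y / f y + 2 * (exp (\<kappa> x) * exp
        (\<kappa> x)) * r * mu" .
qed

end

section \<open>Charts and tangent vectors\<close>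

lemma has_dirderiv_frechet:
  fixes g :: "real ^ 'n::finite \<Rightarrow> real"
  assumes "g differentiable (at x)"
  shows "has_dirderiv i g x (frechet_derivative g (at x) (axis i 1))"
proof -
  let ?g' = "frechet_derivative g (at x)"
  have g: "(g has_derivative ?g') (at (x + 0 *\<^sub>R axis i 1))" using frechet_derivative_works[THEN iffD1,
        OF assms] by simp
  have "((\<lambda>t::real. x + t *\<^sub>R axis i 1) has_derivative (\<lambda>t. t *\<^sub>R axis i 1)) (at 0)"
    by (auto intro!: derivative_eq_intros)
  from has_derivative_compose[OF this g]
  have "((\<lambda>t. g (x + t *\<^sub>R axis i 1)) has_derivative (\<lambda>t. ?g' (t *\<^sub>R axis i 1))) (at 0)" .
  moreover have "(\<lambda>t. ?g' (t *\<^sub>R axis i 1)) = (*) (?g' (axis i 1))"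
    using linear_cmul[OF linear_frechet_derivative[OF assms]] by (simp add: fun_eq_iff)
  ultimately show ?thesis by (simp add: has_dirderiv_def has_field_derivative_def)
qed

lemma connected_space_locally_constant:
  assumes "connected_space M"
    and loc: "\<And>p. p \<in> topspace M \<Longrightarrow> \<exists>V. openin M V \<and> p \<in> V \<and>
          (\<forall>q\<in>V. g q = g p)"
    and p: "p \<in> topspace M" and q: "q \<in> topspace M"
  shows "g p = g q"
proof (rule ccontr)
  assume ne: "g p \<noteq> g q"
  \<comment> \<open>An arbitrary \<open>P\<close> serves both halves of the separation, equality and
    inequality with \<open>g p\<close>.\<close>
  have op: "openin M {r \<in> topspace M. P (g r)}" for P
  proof (subst openin_subopen, intro ballI)
    fix r assume r: "r \<in> {r \<in> topspace M. P (g r)}"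
    then obtain V where V: "openin M V" "r \<in> V" "\<forall>q\<in>V. g q = g r" using loc by blast
    then have "V \<subseteq> {r \<in> topspace M. P (g r)}" using r openin_subset by fastforce
    then show "\<exists>T. openin M T \<and> r \<in> T \<and> T \<subseteq> {r \<in> topspace M. P (g r)}"
          using V by blast
  qed
  define E1 E2 where "E1 = {r \<in> topspace M. g r = g p}" and "E2 = {r \<in> topspace M. g r \<noteq> g p}"
  have "openin M E1" unfolding E1_def by (rule op)
  moreover have "openin M E2" unfolding E2_def by (rule op)
  moreover have "topspace M \<subseteq> E1 \<union> E2" "E1 \<inter> E2 = {}" unfolding E1_def E2_def by auto
  moreover have "p \<in> E1" "q \<in> E2" unfolding E1_def E2_def using p q ne[symmetric] by simp_all
  then have "E1 \<noteq> {}" "E2 \<noteq> {}" by auto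
  ultimately show False using connected_spaceD[OF assms(1)] by metis
qed

section \<open>Charts as homeomorphisms\<close>

context
  fixes M :: "'m topology" and c :: "('m, 'n::finite) chart"
  assumes c: "is_chart M c"
begin

lemma chart_dom_subset: "chart_dom c \<subseteq> topspace M"
  using c openin_subset by (auto simp: is_chart_def)

lemma chart_inj: "inj_on (snd c) (chart_dom c)"
  using c chart_dom_subset homeomorphic_imp_injective_map[of "subtopology M (chart_dom c)" _ "snd c"]
  by (auto simp: is_chart_def Int_absorb1)

lemma chart_inv_chart: "p \<in> chart_dom c \<Longrightarrow> chart_inv c (snd c p) = p"
  unfolding chart_inv_def by (rule inv_into_f_f[OF chart_inj])

lemma chart_inv_in_dom: "x \<in> chart_img c \<Longrightarrow> chart_inv c x \<in> chart_dom c"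
  by (simp add: chart_inv_def chart_img_def inv_into_into)

lemma chart_chart_inv: "x \<in> chart_img c \<Longrightarrow> snd c (chart_inv c x) = x"
  by (simp add: chart_inv_def chart_img_def f_inv_into_f)

lemma chart_in_img: "p \<in> chart_dom c \<Longrightarrow> snd c p \<in> chart_img c"
  by (simp add: chart_img_def)

lemma open_chart_image:
  assumes "openin M U"
  shows "open (snd c ` (chart_dom c \<inter> U))"
proof -
  have "openin (subtopology M (chart_dom c)) (chart_dom c \<inter> U)"
    using assms by (auto simp: openin_subtopology)
  moreover have "open_map (subtopology M (chart_dom c)) (top_of_set (chart_img c)) (snd c)"
    using c homeomorphic_imp_open_map by (auto simp: is_chart_def)
  ultimately have "openin (top_of_set (chart_img c)) (snd c ` (chart_dom c \<inter> U))"
    by (auto simp: open_map_def)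
  then show ?thesis using c openin_open_eq by (auto simp: is_chart_def)
qed

lemma openin_chart_preimage:
  assumes "open B"
  shows "openin M {p \<in> chart_dom c. snd c p \<in> B}"
proof -
  have "continuous_map (subtopology M (chart_dom c)) (top_of_set (chart_img c)) (snd c)"
    using c homeomorphic_imp_continuous_map by (auto simp: is_chart_def)
  then have "continuous_map (subtopology M (chart_dom c)) euclidean (snd c)"
    by (simp add: continuous_map_in_subtopology)
  then have "openin (subtopology M (chart_dom c)) {p \<in> topspace (subtopology M (chart_dom c)). snd c p \<in> B}"
    using assms by (auto simp: continuous_map_def)
  moreover have "{p \<in> topspace (subtopology M (chart_dom c)). snd c p \<in> B} = {p \<in> chart_dom c. snd
        c p \<in> B}"
    using chart_dom_subset by auto
  ultimately have "openin (subtopology M (chart_dom c)) {p \<in> chart_dom c. snd c p \<in> B}" by (simp only:)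
  moreover have "openin M (chart_dom c)" using c by (simp add: is_chart_def)
  ultimately show ?thesis by (rule openin_trans_full)
qed

end

lemma one_form_coeff:
  fixes \<theta> :: "'m \<Rightarrow> ('m, 'n::finite) tvector \<Rightarrow> real"
  assumes "one_form A \<theta>" "c \<in> A" "x \<in> chart_img c"
  shows "\<exists>t. \<forall>y. local_rep A c \<theta> x y = t \<bullet> y"
proof -
  obtain b :: "real ^ 'n \<Rightarrow> real ^ 'n" where b: "\<forall>x\<in>chart_img c. \<forall>y. local_rep A
        c \<theta> x y = (\<Sum>i\<in>UNIV. b x $ i * y $ i)"
    using assms(1,2) unfolding one_form_def by blast
  then have "\<forall>y. local_rep A c \<theta> x y = b x \<bullet> y" using assms(3) by (simp add: inner_vec_def)
  then show ?thesis by blast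
qed

section \<open>Tangent vectors in coordinates\<close>

locale manifold =
  fixes M :: "'m topology" and A :: "('m, 'n::finite) chart set"
  assumes manifold: "smooth_manifold M A"
begin

lemma chart: "c \<in> A \<Longrightarrow> is_chart M c"
  using manifold by (auto simp: smooth_manifold_def)

lemma transition_differentiable:
  assumes "c \<in> A" "d \<in> A" "x \<in> chart_img c" "chart_inv c x \<in> chart_dom d"
  shows "(snd d \<circ> chart_inv c) differentiable (at x)"
proof -
  let ?S = "snd c ` (chart_dom c \<inter> chart_dom d)"
  have "smooth_transition c d" using manifold assms by (auto simp: smooth_manifold_def)
  then have "Ck_on (Suc 0) ?S (snd d \<circ> chart_inv c)"
    unfolding smooth_transition_def smooth_on_def by blast
  then have "(snd d \<circ> chart_inv c) differentiable_on ?S" by simp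
  moreover have "open ?S" using open_chart_image[OF chart] chart assms by (auto simp: is_chart_def)
  moreover have "snd c (chart_inv c x) \<in> ?S"
    using chart_inv_in_dom[OF chart[OF assms(1)] assms(3)] assms(4) by (intro imageI IntI)
  ultimately show ?thesis
    unfolding chart_chart_inv[OF chart[OF assms(1)] assms(3)] using differentiable_on_eq_differentiable_at by blast
qed

lemma coord_tvector_same:
  assumes "c \<in> A" "x \<in> chart_img c"
  shows "coord_tvector A c x y c = y"
proof -
  note ch = chart[OF assms(1)]
  have "((\<lambda>x. x) has_derivative (\<lambda>y. y)) (at x)" by simp
  then have "((snd c \<circ> chart_inv c) has_derivative (\<lambda>y. y)) (at x)"
    by (rule has_derivative_transform_within_open[of _ _ _ _ "chart_img c"])
       (use ch assms chart_chart_inv[OF ch] in \<open>auto simp: is_chart_def\<close>)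
  then have "frechet_derivative (snd c \<circ> chart_inv c) (at x) = (\<lambda>y. y)"
    by (rule frechet_derivative_at[symmetric])
  then show ?thesis using assms chart_inv_in_dom[OF ch] by (simp add: coord_tvector_def)
qed

lemma coord_tvector_tangent:
  assumes c: "c \<in> A" and x: "x \<in> chart_img c"
  shows "coord_tvector A c x y \<in> tangent_space A (chart_inv c x)"
proof -
  note ch = chart[OF c]
  let ?p = "chart_inv c x"
  have chain: "frechet_derivative (snd e \<circ> chart_inv c) (at x) y =
      frechet_derivative (snd e \<circ> chart_inv d) (at (snd d ?p)) (frechet_derivative (snd d \<circ>
            chart_inv c) (at x) y)"
    if d: "d \<in> A" and e: "e \<in> A" and p: "?p \<in> chart_dom d" "?p \<in> chart_dom e" for d e
  proof -
    note chd = chart[OF d]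
    have inv: "chart_inv d (snd d ?p) = ?p" by (rule chart_inv_chart[OF chd p(1)])
    have 1: "((snd d \<circ> chart_inv c) has_derivative frechet_derivative (snd d \<circ> chart_inv c) (at x))
          (at x)"
      by (rule frechet_derivative_works[THEN iffD1, OF transition_differentiable[OF c d x p(1)]])
    have "(snd e \<circ> chart_inv d) differentiable (at (snd d ?p))"
      by (rule transition_differentiable[OF d e chart_in_img[OF chd p(1)]]) (simp only: inv p(2))
    from frechet_derivative_works[THEN iffD1, OF this] have 2: "((snd e \<circ> chart_inv d) has_derivative
          frechet_derivative (snd e \<circ> chart_inv d) (at (snd d ?p))) (at ((snd d \<circ> chart_inv c) x))"
      by (simp only: comp_apply)
    have 3: "((snd e \<circ> chart_inv d) \<circ> (snd d \<circ> chart_inv c) has_derivative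
        frechet_derivative (snd e \<circ> chart_inv d) (at (snd d ?p)) \<circ> frechet_derivative (snd d
              \<circ> chart_inv c) (at x)) (at x)"
      by (rule diff_chain_at[OF 1 2])
    let ?S = "snd c ` (chart_dom c \<inter> chart_dom d)"
    have S: "open ?S" using open_chart_image[OF ch] chd by (auto simp: is_chart_def)
    have "snd c ?p \<in> ?S" using chart_inv_in_dom[OF ch x] p(1) by (intro imageI IntI)
    then have xS: "x \<in> ?S" unfolding chart_chart_inv[OF ch x] .
    \<comment> \<open>Inserting the chart \<open>d\<close> changes nothing only on the overlap with
      its domain, so the chain rule is transferred on that open set.\<close>
    have "((snd e \<circ> chart_inv c) has_derivative
        frechet_derivative (snd e \<circ> chart_inv d) (at (snd d ?p)) \<circ> frechet_derivative (snd d
              \<circ> chart_inv c) (at x)) (at x)"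
      by (rule has_derivative_transform_within_open[OF 3 S xS])
         (auto simp: chart_inv_chart[OF ch] chart_inv_chart[OF chd])
    from fun_cong[OF frechet_derivative_at[OF this], of y] show ?thesis by simp
  qed
  show ?thesis
    unfolding tangent_space_def
  proof (intro CollectI conjI ballI allI impI)
    fix d e assume "d \<in> A" "e \<in> A" "?p \<in> chart_dom d \<inter> chart_dom e"
    then show "coord_tvector A c x y e = frechet_derivative (snd e \<circ> chart_inv d) (at (snd d ?p))
          (coord_tvector A c x y d)"
      using chain[of d e] by (simp add: coord_tvector_def)
  qed (auto simp: coord_tvector_def)
qed

lemma tangent_eq_coord_tvector:
  assumes "v \<in> tangent_space A p" "c \<in> A" "p \<in> chart_dom c"
  shows "v = coord_tvector A c (snd c p) (v c)"
proof
  fix d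
  have inv: "chart_inv c (snd c p) = p" by (rule chart_inv_chart[OF chart[OF assms(2)] assms(3)])
  show "v d = coord_tvector A c (snd c p) (v c) d"
  proof (cases "d \<in> A \<and> p \<in> chart_dom d")
    case True
    then have "v d = frechet_derivative (snd d \<circ> chart_inv c) (at (snd c p)) (v c)"
      using assms unfolding tangent_space_def by blast
    then show ?thesis using True by (simp only: coord_tvector_def inv if_True simp_thms)
  next
    case False
    then have "v d = 0" using assms(1) unfolding tangent_space_def by blast
    then show ?thesis using False by (simp only: coord_tvector_def inv if_False)
  qed
qed

lemma chart_inv_in_topspace: "c \<in> A \<Longrightarrow> x \<in> chart_img c \<Longrightarrow> chart_inv c x
      \<in> topspace M"
  using chart_dom_subset[OF chart] chart_inv_in_dom[OF chart] by (metis subsetD)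

end

section \<open>Randers metrics in coordinates\<close>

locale randers_manifold = manifold M A for M :: "'m topology" and A :: "('m, 'n::finite) chart set" +
  fixes F \<alpha> \<beta> :: "'m \<Rightarrow> ('m, 'n) tvector \<Rightarrow> real"
  assumes F: "finsler_metric A F" and \<alpha>: "riemannian_metric A \<alpha>" and \<beta>: "one_form A \<beta>"
    and dual: "p \<in> topspace M \<Longrightarrow> dual_norm A \<alpha> \<beta> p < 1"
    and F_eq: "p \<in> topspace M \<Longrightarrow> v \<in> tangent_space A p \<Longrightarrow> F p v =
          \<alpha> p v + \<beta> p v"
begin

lemma local_F: "c \<in> A \<Longrightarrow> x \<in> chart_img c \<Longrightarrow> local_rep A c F x y =
      local_rep A c \<alpha> x y + local_rep A c \<beta> x y"
  unfolding local_rep_def by (intro F_eq chart_inv_in_topspace coord_tvector_tangent)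

lemma local_coeffs:
  assumes "c \<in> A" "x \<in> chart_img c"
  obtains a :: "real ^ 'n ^ 'n" and b :: "real ^ 'n" where "transpose a = a" "\<And>y. y \<noteq> 0
        \<Longrightarrow> 0 < y \<bullet> (a *v y)"
    "\<And>y. local_rep A c \<alpha> x y = sqrt (y \<bullet> (a *v y))" "\<And>y. local_rep A c \<beta> x y = b
          \<bullet> y"
proof -
  have quad: "(\<Sum>i\<in>UNIV. \<Sum>j\<in>UNIV. a $ i $ j * y $ i * y $ j) = y \<bullet> (a *v y)" for a ::
        "real ^ 'n ^ 'n" and y
    by (simp add: inner_vec_def matrix_vector_mult_def sum_distrib_left mult_ac)
  obtain a :: "real ^ 'n \<Rightarrow> real ^ 'n ^ 'n" where a: "\<forall>x\<in>chart_img c. transpose (a x) =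
        a x \<and> (\<forall>y. y \<noteq> 0 \<longrightarrow> 0 < y \<bullet> (a x *v y)) \<and>
        (\<forall>y. local_rep A c \<alpha> x y = sqrt (\<Sum>i\<in>UNIV. \<Sum>j\<in>UNIV. a x $ i $ j * y $ i
              * y $ j))"
    using \<alpha> assms(1) unfolding riemannian_metric_def by blast
  from a assms(2) have "transpose (a x) = a x" "\<And>y. y \<noteq> 0 \<Longrightarrow> 0 < y \<bullet> (a x *v y)"
    "\<And>y. local_rep A c \<alpha> x y = sqrt (y \<bullet> (a x *v y))"
    unfolding quad by blast+
  moreover obtain b :: "real ^ 'n" where "\<And>y. local_rep A c \<beta> x y = b \<bullet> y"
    using one_form_coeff[OF \<beta> assms] by blast
  ultimately show ?thesis using that by blast
qed

text \<open>\<open>dual_norm\<close> is a \<open>Sup\<close> and controls its members only if the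
  set is bounded above. The bound 1 comes from \<open>F \<ge> 0\<close> on opposite vectors; then
  \<open>dual_norm < 1\<close>, applied to the direction \<open>- y\<close>, makes the inequality
  strict.\<close>

lemma local_F_pos:
  assumes c: "c \<in> A" and x: "x \<in> chart_img c" and y: "y \<noteq> 0"
  shows "0 < local_rep A c F x y"
proof -
  note ch = chart[OF c]
  obtain a :: "real ^ 'n ^ 'n" and b :: "real ^ 'n" where pos: "\<And>y. y \<noteq> 0 \<Longrightarrow> 0 < y
        \<bullet> (a *v y)"
    and alpha: "\<And>y. local_rep A c \<alpha> x y = sqrt (y \<bullet> (a *v y))" and be: "\<And>y. local_rep
          A c \<beta> x y = b \<bullet> y"
    using local_coeffs[OF c x] by metis
  have alpha_minus: "local_rep A c \<alpha> x (- y) = local_rep A c \<alpha> x y" for y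
    using matrix_vector_mult_scaleR[of a "-1" y] by (simp add: alpha)
  have be_minus: "local_rep A c \<beta> x (- y) = - local_rep A c \<beta> x y" for y by (simp add: be)
  have nonneg: "0 \<le> local_rep A c F x y" for y
    using F c x unfolding finsler_metric_def Let_def by blast
  have le: "local_rep A c \<beta> x y \<le> local_rep A c \<alpha> x y" for y
    using nonneg[of "- y"] by (simp add: local_F[OF c x] alpha_minus be_minus)
  let ?p = "chart_inv c x"
  let ?R = "{\<beta> ?p v / \<alpha> ?p v | v. v \<in> tangent_space A ?p \<and> v \<noteq> (\<lambda>_. 0)}"
  have "bdd_above ?R"
  proof (rule bdd_aboveI[of _ 1])
    fix r assume "r \<in> ?R"
    then obtain v where v: "v \<in> tangent_space A ?p" "r = \<beta> ?p v / \<alpha> ?p v" by blast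
    have "v = coord_tvector A c x (v c)"
      using tangent_eq_coord_tvector[OF v(1) c chart_inv_in_dom[OF ch x]] chart_chart_inv[OF ch x] by simp
    then have "r = local_rep A c \<beta> x (v c) / local_rep A c \<alpha> x (v c)" unfolding v(2) local_rep_def
          by metis
    \<comment> \<open>If \<open>v c = 0\<close>, the quotient is 0 by the convention for division by
      0.\<close>
    then show "r \<le> 1" using le[of "v c"] alpha[of "v c"] pos[of "v c"]
      by (cases "v c = 0") (auto simp: divide_le_eq)
  qed
  moreover have "local_rep A c \<beta> x (- y) / local_rep A c \<alpha> x (- y) \<in> ?R"
  proof -
    have "coord_tvector A c x (- y) \<noteq> (\<lambda>_. 0)"
      using coord_tvector_same[OF c x, of "- y"] y by auto
    then show ?thesis using coord_tvector_tangent[OF c x] unfolding local_rep_def by blast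
  qed
  ultimately have "local_rep A c \<beta> x (- y) / local_rep A c \<alpha> x (- y) \<le> dual_norm A \<alpha>
        \<beta> ?p"
    unfolding dual_norm_def by (rule cSup_upper[rotated])
  also have "\<dots> < 1" by (rule dual[OF chart_inv_in_topspace[OF c x]])
  finally have "- local_rep A c \<beta> x y < local_rep A c \<alpha> x y"
    using pos[OF y] by (simp add: alpha_minus be_minus) (simp add: alpha divide_less_eq less_divide_eq)
  then show ?thesis by (simp add: local_F[OF c x])
qed

end

section \<open>Conformally flat Randers manifolds\<close>

locale conformally_flat_randers = randers_manifold M A F \<alpha> \<beta>
  for M :: "'m topology" and A :: "('m, 'n::finite) chart set" and F \<alpha> \<beta> +
  fixes F' :: "'m \<Rightarrow> ('m, 'n) tvector \<Rightarrow> real" and \<kappa> :: "'m \<Rightarrow> real"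
  assumes mink: "locally_minkowskian M A F'" and \<kappa>: "smooth_scalar A \<kappa>"
    and conf: "p \<in> topspace M \<Longrightarrow> v \<in> tangent_space A p \<Longrightarrow> F p v = exp
          (\<kappa> p) * F' p v"
    and connected: "connected_space M"
begin

definition mink_chart :: "('m, 'n) chart \<Rightarrow> bool" where
  "mink_chart c \<longleftrightarrow> c \<in> A \<and>
    (\<forall>x\<in>chart_img c. \<forall>x'\<in>chart_img c. \<forall>y. local_rep A c F' x y = local_rep A c
          F' x' y)"

lemma mink_chart_around: "p \<in> topspace M \<Longrightarrow> \<exists>c. mink_chart c \<and> p \<in> chart_dom c"
  using mink unfolding locally_minkowskian_def mink_chart_def by blast

lemma mink_chart_atlas: "mink_chart c \<Longrightarrow> c \<in> A"
  by (simp add: mink_chart_def)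

lemma mink_chart_const:
  "mink_chart c \<Longrightarrow> x \<in> chart_img c \<Longrightarrow> x' \<in> chart_img c \<Longrightarrow>
        local_rep A c F' x y = local_rep A c F' x' y"
  unfolding mink_chart_def by blast

lemma local_conf: "c \<in> A \<Longrightarrow> x \<in> chart_img c \<Longrightarrow>
    local_rep A c F x y = exp (\<kappa> (chart_inv c x)) * local_rep A c F' x y"
  unfolding local_rep_def by (intro conf chart_inv_in_topspace coord_tvector_tangent)

section \<open>The zero set of the 1-form\<close>

lemma local_odd:
  assumes "c \<in> A" "x \<in> chart_img c"
  shows "local_rep A c F x y - local_rep A c F x (- y) = 2 * local_rep A c \<beta> x y"
proof -
  obtain a :: "real ^ 'n ^ 'n" and b :: "real ^ 'n" where
    alpha: "\<And>y. local_rep A c \<alpha> x y = sqrt (y \<bullet> (a *v y))" and be: "\<And>y. local_rep A c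
          \<beta> x y = b \<bullet> y"
    using local_coeffs[OF assms] by metis
  have "a *v (- y) = - (a *v y)" using matrix_vector_mult_scaleR[of a "-1" y] by simp
  then show ?thesis by (simp add: local_F[OF assms] alpha be)
qed

text \<open>\<open>\<beta>\<close> is the odd part of \<open>F\<close>, so it vanishes at a point
  exactly when \<open>F\<close>, or equivalently \<open>F'\<close>, is reversible there. In a
  Minkowskian chart of \<open>F'\<close> this does not depend on the point.\<close>

lemma beta_zero_chart:
  assumes c: "mink_chart c" and x: "x \<in> chart_img c" and x': "x' \<in> chart_img c"
    and 0: "\<forall>y. local_rep A c \<beta> x y = 0"
  shows "local_rep A c \<beta> x' y = 0"
proof -
  note cA = mink_chart_atlas[OF c]
  have "local_rep A c F x y = local_rep A c F x (- y)" using local_odd[OF cA x, of y] 0 by simp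
  then have "local_rep A c F' x y = local_rep A c F' x (- y)" by (simp add: local_conf[OF cA x])
  then have "local_rep A c F' x' y = local_rep A c F' x' (- y)" by (simp only: mink_chart_const[OF c x x'])
  then have "local_rep A c F x' y = local_rep A c F x' (- y)" by (simp add: local_conf[OF cA x'])
  then show ?thesis using local_odd[OF cA x', of y] by simp
qed

lemma beta_zero_iff:
  assumes c: "c \<in> A" and p: "p \<in> chart_dom c"
  shows "(\<forall>v\<in>tangent_space A p. \<beta> p v = 0) \<longleftrightarrow> (\<forall>y. local_rep A c
        \<beta> (snd c p) y = 0)"
proof -
  note ch = chart[OF c]
  have inv: "chart_inv c (snd c p) = p" by (rule chart_inv_chart[OF ch p])
  show ?thesis
  proof
    assume "\<forall>v\<in>tangent_space A p. \<beta> p v = 0"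
    moreover have "coord_tvector A c (snd c p) y \<in> tangent_space A p" for y
      using coord_tvector_tangent[OF c chart_in_img[OF ch p], of y] by (simp only: inv)
    ultimately show "\<forall>y. local_rep A c \<beta> (snd c p) y = 0" by (simp only: local_rep_def inv) blast
  next
    assume 0: "\<forall>y. local_rep A c \<beta> (snd c p) y = 0"
    show "\<forall>v\<in>tangent_space A p. \<beta> p v = 0"
    proof
      fix v assume v: "v \<in> tangent_space A p"
      have "\<beta> p (coord_tvector A c (snd c p) (v c)) = 0" using 0 by (simp only: local_rep_def inv)
      then show "\<beta> p v = 0" by (simp only: tangent_eq_coord_tvector[OF v c p, symmetric])
    qed
  qed
qed

lemma beta_nonvanishing:
  assumes "\<not> riemannian_metric A F" "p \<in> topspace M"
  shows "\<not> (\<forall>v\<in>tangent_space A p. \<beta> p v = 0)"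
proof
  assume 0: "\<forall>v\<in>tangent_space A p. \<beta> p v = 0"
  \<comment> \<open>A truth value as a locally constant function: openness and closedness of the
    zero set are treated at once.\<close>
  define g where "g = (\<lambda>p. \<forall>v\<in>tangent_space A p. \<beta> p v = 0)"
  have const: "g p = g q" if "q \<in> topspace M" for q
  proof (rule connected_space_locally_constant[OF connected _ assms(2) that])
    fix r assume "r \<in> topspace M"
    then obtain c where c: "mink_chart c" "r \<in> chart_dom c" using mink_chart_around by blast
    note cA = mink_chart_atlas[OF c(1)]
    note ch = chart[OF cA]
    have "g q = g r" if "q \<in> chart_dom c" for q
      unfolding g_def beta_zero_iff[OF cA that] beta_zero_iff[OF cA c(2)]
      using beta_zero_chart[OF c(1)] chart_in_img[OF ch that] chart_in_img[OF ch c(2)] by blast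
    moreover have "openin M (chart_dom c)" using ch by (simp add: is_chart_def)
    ultimately show "\<exists>V. openin M V \<and> r \<in> V \<and> (\<forall>q\<in>V. g q = g r)" using c(2) by blast
  qed
  have "local_rep A c F x y = local_rep A c \<alpha> x y" if c: "c \<in> A" and x: "x \<in> chart_img c" for c x y
  proof -
    have "g (chart_inv c x)" using const[OF chart_inv_in_topspace[OF c x]] 0 by (simp add: g_def)
    then have "local_rep A c \<beta> x y = 0"
      unfolding local_rep_def g_def using coord_tvector_tangent[OF c x] by blast
    then show ?thesis by (simp add: local_F[OF c x])
  qed
  then have "riemannian_metric A F"
    using \<alpha> unfolding riemannian_metric_def by (simp cong: conj_cong ball_cong)
  then show False using assms(1) by contradiction
qed

lemma kappa_critical:
  assumes n: "CARD('n) \<ge> 2" and nr: "\<not> riemannian_metric A F"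
    and wisc: "weakly_isotropic_scalar_curvature A F" and c: "mink_chart c" and x: "x \<in> chart_img c"
  shows "((\<kappa> \<circ> chart_inv c) has_derivative (\<lambda>_. 0)) (at x)"
proof -
  note cA = mink_chart_atlas[OF c]
  note ch = chart[OF cA]
  let ?X = "chart_img c"
  have X: "open ?X" using ch by (simp add: is_chart_def)
  define K where "K = \<kappa> \<circ> chart_inv c"
  have "Ck_on (Suc (Suc 0)) ?X K" using \<kappa> cA unfolding smooth_scalar_def smooth_on_def K_def by blast
  then have K1: "K differentiable (at x)" and K2: "(\<lambda>x. frechet_derivative K (at x) v) differentiable
        (at x)" if "x \<in> ?X" for x v
    using that X by (auto simp: differentiable_on_eq_differentiable_at)
  define k where "k x = (\<chi> i. frechet_derivative K (at x) (axis i 1))" for x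
  define H where "H x j = (\<chi> l. frechet_derivative (\<lambda>x. frechet_derivative K (at x) (axis l 1))
        (at x) (axis j 1))" for x j
  obtain a0 :: "real ^ 'n ^ 'n" and b0 :: "real ^ 'n" where ab: "transpose a0 = a0" "\<And>y. y \<noteq> 0
        \<Longrightarrow> 0 < y \<bullet> (a0 *v y)"
    "\<And>y. local_rep A c \<alpha> x y = sqrt (y \<bullet> (a0 *v y))" "\<And>y. local_rep A c \<beta> x y =
          b0 \<bullet> y"
    using local_coeffs[OF cA x] by metis
  \<comment> \<open>At the fixed point \<open>x\<close> one has \<open>F' = s * F\<close>, so the
    covector is scaled by \<open>s\<close> and the quadratic form by its square.\<close>
  define s where "s = exp (- K x)"
  have s: "s > 0" by (simp add: s_def)
  define a where "a = s\<^sup>2 *\<^sub>R a0"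
  define b where "b = s *\<^sub>R b0"
  have quad: "y \<bullet> (a *v y) = s\<^sup>2 * (y \<bullet> (a0 *v y))" for y
    by (simp add: a_def scaleR_matrix_vector_assoc[symmetric])
  have F'x: "local_rep A c F' x y = sqrt (y \<bullet> (a *v y)) + b \<bullet> y" for y
  proof -
    have "local_rep A c F' x y = s * local_rep A c F x y"
      by (simp add: local_conf[OF cA x] s_def K_def exp_add[symmetric] mult.assoc[symmetric])
    then show ?thesis using s
      by (simp add: local_F[OF cA x] ab quad b_def real_sqrt_mult distrib_left)
  qed
  have b: "b \<noteq> 0"
  proof
    assume "b = 0"
    then have "\<forall>y. local_rep A c \<beta> x y = 0" using s by (simp add: ab b_def)
    then show False
      using beta_nonvanishing[OF nr chart_inv_in_topspace[OF cA x]] beta_zero_iff[OF cA chart_inv_in_dom[OF ch x]]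
        chart_chart_inv[OF ch x] by simp
  qed
  interpret randers_norm a b
  proof
    show "transpose a = a" using ab(1) by (simp add: a_def transpose_def vec_eq_iff)
    show "0 < y \<bullet> (a *v y)" if "y \<noteq> 0" for y using ab(2)[OF that] s by (simp add: quad)
    show "0 < sqrt (y \<bullet> (a *v y)) + b \<bullet> y" if "y \<noteq> 0" for y
      using local_F_pos[OF cA x that] by (simp add: local_conf[OF cA x] F'x zero_less_mult_iff)
  qed
  interpret conformal_randers a b ?X K k H "local_rep A c F"
  proof
    show "open ?X" by (rule X)
    show "has_dirderiv i K z (k z $ i)" if "z \<in> ?X" for z i
      using has_dirderiv_frechet[OF K1[OF that]] by (simp add: k_def)
    show "has_dirderiv j (\<lambda>x. k x $ l) z (H z j $ l)" if "z \<in> ?X" for z j l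
      using has_dirderiv_frechet[OF K2[OF that, of "axis l 1"]] by (simp add: k_def H_def)
    \<comment> \<open>The norm read off at \<open>x\<close> serves for every \<open>z\<close>, since
      the chart is Minkowskian for \<open>F'\<close>.\<close>
    show "local_rep A c F z y = exp (K z) * f y" if "z \<in> ?X" for z y
      using local_conf[OF cA that, of y] mink_chart_const[OF c that x, of y] F'x[of y]
      by (simp add: K_def f_def alpha_def)
  qed
  obtain \<theta> \<mu> where \<theta>: "one_form A \<theta>" and eq: "\<forall>c\<in>A.
        \<forall>x\<in>chart_img c. \<forall>y. y \<noteq> 0 \<longrightarrow>
        scalar_curvature (local_rep A c F) x y =
          real CARD('n) * (real CARD('n) - 1) * (local_rep A c \<theta> x y / local_rep A c F x y + \<mu>
                (chart_inv c x))"
    using wisc unfolding weakly_isotropic_scalar_curvature_def by blast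
  obtain t where t: "\<And>y. local_rep A c \<theta> x y = t \<bullet> y" using one_form_coeff[OF \<theta> cA
        x] by blast
  have "k x = 0"
    by (rule conformal_factor_critical[OF x b n, of "real CARD('n) * (real CARD('n) - 1)" t "\<mu> (chart_inv c x)"])
       (use eq cA x in \<open>simp add: t\<close>)
  then have k0: "frechet_derivative K (at x) (axis i 1) = 0" for i by (simp add: k_def vec_eq_iff)
  have lin: "linear (frechet_derivative K (at x))" by (rule linear_frechet_derivative[OF K1[OF x]])
  have "frechet_derivative K (at x) v = 0" for v
  proof -
    have "frechet_derivative K (at x) v = frechet_derivative K (at x) (\<Sum>i\<in>UNIV. v $ i *\<^sub>R axis i 1)"
      by (simp add: basis_expansion scalar_mult_eq_scaleR[symmetric])
    then show ?thesis by (simp only: linear_sum[OF lin] linear_cmul[OF lin] k0) simp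
  qed
  then have "frechet_derivative K (at x) = (\<lambda>_. 0)" by blast
  then show ?thesis using frechet_derivative_works[THEN iffD1, OF K1[OF x]] by (simp only: K_def)
qed

lemma kappa_constant:
  assumes "CARD('n) \<ge> 2" "\<not> riemannian_metric A F" "weakly_isotropic_scalar_curvature A F"
    and p: "p \<in> topspace M" and q: "q \<in> topspace M"
  shows "\<kappa> p = \<kappa> q"
proof (rule connected_space_locally_constant[OF connected _ p q])
  fix r assume "r \<in> topspace M"
  then obtain c where c: "mink_chart c" "r \<in> chart_dom c" using mink_chart_around by blast
  note ch = chart[OF mink_chart_atlas[OF c(1)]]
  have "open (chart_img c)" using ch by (simp add: is_chart_def)
  \<comment> \<open>A chart image need not be connected, so constancy is derived on a ball inside
    it.\<close>
  then obtain e where e: "e > 0" "ball (snd c r) e \<subseteq> chart_img c"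
    using chart_in_img[OF ch c(2)] open_contains_ball by blast
  let ?V = "{s \<in> chart_dom c. snd c s \<in> ball (snd c r) e}"
  have "\<kappa> s = \<kappa> r" if "s \<in> ?V" for s
  proof -
    have "((\<kappa> \<circ> chart_inv c) has_derivative (\<lambda>_. 0)) (at z within ball (snd c r) e)" if "z
          \<in> ball (snd c r) e" for z
      using kappa_critical[OF assms(1-3) c(1)] that e(2) has_derivative_at_withinI by blast
    then have "\<exists>d. \<forall>z\<in>ball (snd c r) e. (\<kappa> \<circ> chart_inv c) z = d"
      by (rule has_derivative_zero_constant[OF convex_ball])
    moreover have "snd c s \<in> ball (snd c r) e" "snd c r \<in> ball (snd c r) e" using that e(1) by auto
    ultimately have "(\<kappa> \<circ> chart_inv c) (snd c s) = (\<kappa> \<circ> chart_inv c) (snd c r)" by metis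
    then show ?thesis using that c(2) by (simp add: chart_inv_chart[OF ch])
  qed
  moreover have "openin M ?V" by (rule openin_chart_preimage[OF ch open_ball])
  moreover have "r \<in> ?V" using c(2) e(1) by simp
  ultimately show "\<exists>V. openin M V \<and> r \<in> V \<and> (\<forall>q\<in>V. \<kappa> q = \<kappa> r)"
        by blast
qed

lemma F_locally_minkowskian:
  assumes "CARD('n) \<ge> 2" "\<not> riemannian_metric A F" "weakly_isotropic_scalar_curvature A F"
  shows "locally_minkowskian M A F"
  unfolding locally_minkowskian_def
proof (intro conjI ballI)
  fix p assume "p \<in> topspace M"
  then obtain c where c: "mink_chart c" "p \<in> chart_dom c" using mink_chart_around by blast
  note cA = mink_chart_atlas[OF c(1)]
  have "local_rep A c F x y = local_rep A c F x' y" if "x \<in> chart_img c" "x' \<in> chart_img c" for x x' y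
    using kappa_constant[OF assms chart_inv_in_topspace[OF cA that(1)] chart_inv_in_topspace[OF cA that(2)]]
      mink_chart_const[OF c(1) that, of y]
    by (simp add: local_conf[OF cA that(1)] local_conf[OF cA that(2)])
  then show "\<exists>c\<in>A. p \<in> chart_dom c \<and> (\<forall>x\<in>chart_img c.
        \<forall>x'\<in>chart_img c. \<forall>y. local_rep A c F x y = local_rep A c F x' y)"
    using cA c(2) by blast
qed (rule F)

end

theorem theorem1p2:
  fixes M :: "'m topology"
    and A :: "('m, 'n::finite) chart set"
    and F :: "'m \<Rightarrow> ('m, 'n) tvector \<Rightarrow> real"
  assumes "smooth_manifold M A"
    and "connected_space M"
    and "CARD('n) \<ge> 2"
    and "randers_metric M A F"
    and "\<not> riemannian_metric A F"
    and "conformally_flat M A F"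
    and "weakly_isotropic_scalar_curvature A F"
  shows "locally_minkowskian M A F"
proof -
  obtain \<alpha> \<beta> where "finsler_metric A F" "riemannian_metric A \<alpha>" "one_form A \<beta>"
    "\<forall>p\<in>topspace M. dual_norm A \<alpha> \<beta> p < 1"
    "\<forall>p\<in>topspace M. \<forall>v\<in>tangent_space A p. F p v = \<alpha> p v + \<beta> p v"
    using assms(4) unfolding randers_metric_def by blast
  moreover obtain F' \<kappa> where "locally_minkowskian M A F'" "smooth_scalar A \<kappa>"
    "\<forall>p\<in>topspace M. \<forall>v\<in>tangent_space A p. F p v = exp (\<kappa> p) * F' p v"
    using assms(6) unfolding conformally_flat_def conformally_related_def by blast
  ultimately interpret conformally_flat_randers M A F \<alpha> \<beta> F' \<kappa>
    using assms(1,2) by unfold_locales blast+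
  show ?thesis using F_locally_minkowskian assms(3,5,7) .
qed

end
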